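(* Let $(X_n)_{n\ge0}$ be up-down chains on finite pairwise disjoint sets $(\mathbb S_n)_{n\ge0}$ with $\mathbb S_0=\{\varnothing\}$, whose up- and down-steps satisfy $p^\uparrow_np^\downarrow_{n+1}=\beta_np^\downarrow_np^\uparrow_{n-1}+(1-\beta_n)\mathrm{Id}$ for $n\ge1$ with $\beta_n\in(0,1)$, and let $(c_n)_{n\ge0}$ be positive numbers with $c_{n-1}/c_n=\beta_n$, $n\ge1$, and $c_n\to\infty$. Suppose that for every $n\ge1$ there are $r_n,s_n\in\mathbb S_n$ with $M_n(s_n)>0$, $n=\min\{m\ge0:p_n^m(r_n,s_n)>0\}$, and $p^\downarrow_{n+1}(r_{n+1},r_n)=1$. Let $E$ be a compact metric space, $\iota:\mathbb S\to E$ and $(d^o_s)_{s\in\mathbb S}\subset C(E)$ satisfy (L1)--(L3) of the context. Then, with $\Delta^*_n$ the separation distance of the continuous-time variant of $X_n$, $\mathcal T(t)$ the semigroup of the limiting process $F$, and $\Delta_F$ the separation distance of $F$, $$\Delta^*_n(t)=\sup_{x\in E,\ f\in H_n^+}\Big(1-\frac{(\mathcal T(t)f^o)(x)}{[h^o_\varnothing]f^o}\Big),\qquad n\ge0,\ t\ge0.$$ Consequently, for every $t\ge0$, $\Delta^*_n(t)$ is nondecreasing in $n$ and converges to $\Delta_F(t)$ as $n\to\infty$.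
   Context: $p^\uparrow_n$ ($n\ge0$), $p^\downarrow_n$ ($n\ge1$) are stochastic matrices from $\mathbb S_n$ to $\mathbb S_{n+1}$, resp. $\mathbb S_{n-1}$; $X_n$ has transition matrix $p_n=p^\uparrow_np^\downarrow_{n+1}$ and transition operator $T_n$; $M_n=(p^\uparrow_0\cdots p^\uparrow_{n-1})(\varnothing,\cdot)$ is its unique stationary distribution. $\mathbb S=\bigcup_n\mathbb S_n$; $|s|$ is the $n$ with $s\in\mathbb S_n$; $c_{-1}=0$; $(f)_n=f|_{\mathbb S_n}$. $$\Delta^*_n(t)=\sup_{r\in\mathbb S_n,\ f:\mathbb S_n\to(0,\infty)}\Big(1-\frac{(e^{tc_n(T_n-I)}f)(r)}{\int f\,dM_n}\Big).$$ For $s,u\in\mathbb S$: $d_s(u)=(p^\downarrow_{|u|}\cdots p^\downarrow_{|s|+1})(u,s)$ if $|u|\ge|s|$ and $0$ otherwise. $H=\operatorname{span}\{d_s\}_{s\in\mathbb S}$, $H_n=\operatorname{span}\{d_s:|s|\le n\}$, $H_n^+=\{f\in H_n:(f)_n>0\text{ everywhere on }\mathbb S_n\}$. For $f=\sum a_sd_s\in H$, $f^o=\sum a_sd^o_s\in C(E)$ (the $d_s$ are linearly independent). (L1) For every $x\in E$ there are $u_n\in\mathbb S_n$ with $\iota(u_n)\to x$. (L2) $\operatorname{span}\{d^o_s\}$ is dense in $C(E)$. (L3) $\|(d_s)_n-d^o_s\circ\iota|_{\mathbb S_n}\|_\infty\to0$ as $n\to\infty$ for each $s$. $h^o_s=\sum_{|r|\le|s|}(p^\uparrow_{|r|}\cdots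 p^\uparrow_{|s|-1})(r,s)\,\eta_{|r|,|s|}\,d^o_r$ with $\eta_{i,j}=\prod_{m=i}^{j-1}\frac{c_m}{c_{m-1}-c_{j-1}}$. $(\mathcal T(t))_{t\ge0}$ is the unique Feller semigroup on $C(E)$ with $\mathcal T(t)h^o_s=e^{-tc_{|s|-1}}h^o_s$ for all $s$; equivalently $\|T_n^{\lfloor c_nt\rfloor}(f\circ\iota|_{\mathbb S_n})-(\mathcal T(t)f)\circ\iota|_{\mathbb S_n}\|_\infty\to0$ for all $f\in C(E)$, $t\ge0$. $F$ is the Feller process with this semigroup. $[h^o_\varnothing]$ is the unique bounded linear functional on $C(E)$ with $[h^o_\varnothing]d^o_s=M_{|s|}(s)$ for all $s$; $M$, the stationary distribution of $F$, is the probability measure on $E$ with $\int f\,dM=[h^o_\varnothing]f$. (Existence of these objects is known.) $$\Delta_F(t)=\sup_{x\in E,\ f\in C(E),\ f>0}\Big(1-\frac{(\mathcal T(t)f)(x)}{\int_Ef\,dM}\Big).$$ *)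

theory Defs
  imports "HOL-Analysis.Analysis" "HOL-Probability.Probability_Measure"
begin

text \<open>
  Matrices with rows and columns indexed by subsets of a type \<open>'s\<close> are functions
  \<open>'s \<Rightarrow> 's \<Rightarrow> real\<close>; only the entries on the index sets \<open>S n\<close> are ever used.
  Throughout, \<open>S\<close> is the family of state spaces, \<open>pu n\<close> the up-step from \<open>S n\<close> to
  \<open>S (Suc n)\<close>, and \<open>pd n\<close> (for \<open>n \<ge> 1\<close>) the down-step from \<open>S n\<close> to \<open>S (n - 1)\<close>.
\<close>

definition stochastic :: "'s set \<Rightarrow> 's set \<Rightarrow> ('s \<Rightarrow> 's \<Rightarrow> real) \<Rightarrow> bool" where
  "stochastic A B P \<longleftrightarrow>
     (\<forall>r\<in>A. (\<forall>s\<in>B. 0 \<le> P r s) \<and> (\<Sum>s\<in>B. P r s) = 1)"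

definition mat_one :: "'s \<Rightarrow> 's \<Rightarrow> real" where
  "mat_one r s = (if r = s then 1 else 0)"

definition mat_mul :: "'s set \<Rightarrow> ('s \<Rightarrow> 's \<Rightarrow> real) \<Rightarrow> ('s \<Rightarrow> 's \<Rightarrow> real) \<Rightarrow> 's \<Rightarrow> 's \<Rightarrow> real" where
  "mat_mul B P Q r s = (\<Sum>u\<in>B. P r u * Q u s)"

primrec mat_pow :: "'s set \<Rightarrow> ('s \<Rightarrow> 's \<Rightarrow> real) \<Rightarrow> nat \<Rightarrow> 's \<Rightarrow> 's \<Rightarrow> real" where
  "mat_pow B P 0 = mat_one"
| "mat_pow B P (Suc m) = mat_mul B (mat_pow B P m) P"

text \<open>\<open>up_prod S pu i j\<close> is the product \<open>pu i \<cdots> pu (j - 1)\<close>, the identity for \<open>j \<le> i\<close>.\<close>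

primrec up_prod :: "(nat \<Rightarrow> 's set) \<Rightarrow> (nat \<Rightarrow> 's \<Rightarrow> 's \<Rightarrow> real) \<Rightarrow> nat \<Rightarrow> nat \<Rightarrow> 's \<Rightarrow> 's \<Rightarrow> real" where
  "up_prod S pu i 0 = mat_one"
| "up_prod S pu i (Suc j) =
     (if j < i then mat_one else mat_mul (S j) (up_prod S pu i j) (pu j))"

text \<open>\<open>down_prod S pd j i\<close> is the product \<open>pd j \<cdots> pd (i + 1)\<close>, the identity for \<open>j \<le> i\<close>.\<close>

primrec down_prod :: "(nat \<Rightarrow> 's set) \<Rightarrow> (nat \<Rightarrow> 's \<Rightarrow> 's \<Rightarrow> real) \<Rightarrow> nat \<Rightarrow> nat \<Rightarrow> 's \<Rightarrow> 's \<Rightarrow> real" where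
  "down_prod S pd 0 i = mat_one"
| "down_prod S pd (Suc j) i =
     (if j < i then mat_one else mat_mul (S j) (pd (Suc j)) (down_prod S pd j i))"

definition level :: "(nat \<Rightarrow> 's set) \<Rightarrow> 's \<Rightarrow> nat" where
  "level S s = (THE n. s \<in> S n)"

definition trans_mat ::
  "(nat \<Rightarrow> 's set) \<Rightarrow> (nat \<Rightarrow> 's \<Rightarrow> 's \<Rightarrow> real) \<Rightarrow> (nat \<Rightarrow> 's \<Rightarrow> 's \<Rightarrow> real) \<Rightarrow> nat \<Rightarrow> 's \<Rightarrow> 's \<Rightarrow> real" where
  "trans_mat S pu pd n = mat_mul (S (Suc n)) (pu n) (pd (Suc n))"

definition trans_op ::
  "(nat \<Rightarrow> 's set) \<Rightarrow> (nat \<Rightarrow> 's \<Rightarrow> 's \<Rightarrow> real) \<Rightarrow> (nat \<Rightarrow> 's \<Rightarrow> 's \<Rightarrow> real) \<Rightarrow> nat \<Rightarrow> ('s \<Rightarrow> real) \<Rightarrow> 's \<Rightarrow> real" where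
  "trans_op S pu pd n f r = (\<Sum>s\<in>S n. trans_mat S pu pd n r s * f s)"

definition stat :: "(nat \<Rightarrow> 's set) \<Rightarrow> (nat \<Rightarrow> 's \<Rightarrow> 's \<Rightarrow> real) \<Rightarrow> 's \<Rightarrow> nat \<Rightarrow> 's \<Rightarrow> real" where
  "stat S pu e0 n s = up_prod S pu 0 n e0 s"

definition op_exp :: "(('s \<Rightarrow> real) \<Rightarrow> 's \<Rightarrow> real) \<Rightarrow> ('s \<Rightarrow> real) \<Rightarrow> 's \<Rightarrow> real" where
  "op_exp A f r = (\<Sum>k. (A ^^ k) f r / fact k)"

definition sep_chain ::
  "(nat \<Rightarrow> 's set) \<Rightarrow> (nat \<Rightarrow> 's \<Rightarrow> 's \<Rightarrow> real) \<Rightarrow> (nat \<Rightarrow> 's \<Rightarrow> 's \<Rightarrow> real) \<Rightarrow> 's \<Rightarrow> (nat \<Rightarrow> real) \<Rightarrow>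
     nat \<Rightarrow> real \<Rightarrow> real" where
  "sep_chain S pu pd e0 c n t =
     (SUP (r, f) \<in> S n \<times> {f. \<forall>u\<in>S n. 0 < f u}.
        1 - op_exp (\<lambda>g u. t * c n * (trans_op S pu pd n g u - g u)) f r
              / (\<Sum>u\<in>S n. f u * stat S pu e0 n u))"

text \<open>The value outside \<open>\<Union>n. S n\<close> is set to 0, so that equality of functions on
  \<open>\<Union>n. S n\<close> is equality of HOL functions.\<close>

definition dfun :: "(nat \<Rightarrow> 's set) \<Rightarrow> (nat \<Rightarrow> 's \<Rightarrow> 's \<Rightarrow> real) \<Rightarrow> 's \<Rightarrow> 's \<Rightarrow> real" where
  "dfun S pd s u =
     (if u \<in> (\<Union>n. S n) \<and> level S s \<le> level S u
      then down_prod S pd (level S u) (level S s) u s else 0)"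

definition coeffs :: "(nat \<Rightarrow> 's set) \<Rightarrow> ('s \<Rightarrow> real) set" where
  "coeffs S = {a. finite {s. a s \<noteq> 0} \<and> {s. a s \<noteq> 0} \<subseteq> (\<Union>n. S n)}"

definition dcomb :: "(nat \<Rightarrow> 's set) \<Rightarrow> (nat \<Rightarrow> 's \<Rightarrow> 's \<Rightarrow> real) \<Rightarrow> ('s \<Rightarrow> real) \<Rightarrow> 's \<Rightarrow> real" where
  "dcomb S pd a u = (\<Sum>s | a s \<noteq> 0. a s * dfun S pd s u)"

definition Hspace :: "(nat \<Rightarrow> 's set) \<Rightarrow> (nat \<Rightarrow> 's \<Rightarrow> 's \<Rightarrow> real) \<Rightarrow> nat \<Rightarrow> ('s \<Rightarrow> real) set" where
  "Hspace S pd n = {dcomb S pd a | a. a \<in> coeffs S \<and> (\<forall>s. a s \<noteq> 0 \<longrightarrow> level S s \<le> n)}"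

definition Hpos :: "(nat \<Rightarrow> 's set) \<Rightarrow> (nat \<Rightarrow> 's \<Rightarrow> 's \<Rightarrow> real) \<Rightarrow> nat \<Rightarrow> ('s \<Rightarrow> real) set" where
  "Hpos S pd n = {f \<in> Hspace S pd n. \<forall>u\<in>S n. 0 < f u}"

text \<open>The map \<open>f \<mapsto> f\<^sup>o\<close>: the coefficients of \<open>f\<close> are unique because the \<open>d\<^sub>s\<close> are
  linearly independent (\<open>d\<^sub>s\<close> vanishes below level \<open>|s|\<close> and is the indicator of \<open>s\<close> on it).\<close>

definition lift_o ::
  "(nat \<Rightarrow> 's set) \<Rightarrow> (nat \<Rightarrow> 's \<Rightarrow> 's \<Rightarrow> real) \<Rightarrow> ('s \<Rightarrow> 'e::metric_space \<Rightarrow>\<^sub>C real) \<Rightarrow>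
     ('s \<Rightarrow> real) \<Rightarrow> 'e \<Rightarrow>\<^sub>C real" where
  "lift_o S pd d_o f =
     (let a = (THE a. a \<in> coeffs S \<and> f = dcomb S pd a)
      in \<Sum>s | a s \<noteq> 0. a s *\<^sub>R d_o s)"

text \<open>\<open>c_prev c n\<close> is \<open>c\<^bsub>n-1\<^esub>\<close>, with the convention \<open>c\<^bsub>-1\<^esub> = 0\<close>.\<close>

definition c_prev :: "(nat \<Rightarrow> real) \<Rightarrow> nat \<Rightarrow> real" where
  "c_prev c n = (if n = 0 then 0 else c (n - 1))"

definition eta :: "(nat \<Rightarrow> real) \<Rightarrow> nat \<Rightarrow> nat \<Rightarrow> real" where
  "eta c i j = (\<Prod>m\<in>{i..<j}. c m / (c_prev c m - c_prev c j))"

definition h_o ::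
  "(nat \<Rightarrow> 's set) \<Rightarrow> (nat \<Rightarrow> 's \<Rightarrow> 's \<Rightarrow> real) \<Rightarrow> (nat \<Rightarrow> real) \<Rightarrow>
     ('s \<Rightarrow> 'e::metric_space \<Rightarrow>\<^sub>C real) \<Rightarrow> 's \<Rightarrow> 'e \<Rightarrow>\<^sub>C real" where
  "h_o S pu c d_o s =
     (\<Sum>r\<in>(\<Union>m\<in>{..level S s}. S m).
        (up_prod S pu (level S r) (level S s) r s * eta c (level S r) (level S s)) *\<^sub>R d_o r)"

text \<open>On a compact space \<open>'e\<close>, the type \<open>'e \<Rightarrow>\<^sub>C real\<close> is all of \<open>C(E)\<close> with the sup norm.\<close>

definition feller_semigroup ::
  "(real \<Rightarrow> ('e::metric_space \<Rightarrow>\<^sub>C real) \<Rightarrow> ('e \<Rightarrow>\<^sub>C real)) \<Rightarrow> bool" where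
  "feller_semigroup T \<longleftrightarrow>
     (\<forall>t\<ge>0. linear (T t)) \<and>
     (\<forall>t\<ge>0. \<forall>f. norm (T t f) \<le> norm f) \<and>
     (\<forall>t\<ge>0. \<forall>f. (\<forall>x. 0 \<le> apply_bcontfun f x) \<longrightarrow> (\<forall>x. 0 \<le> apply_bcontfun (T t f) x)) \<and>
     (\<forall>t\<ge>0. T t (const_bcontfun 1) = const_bcontfun 1) \<and>
     (\<forall>f. T 0 f = f) \<and>
     (\<forall>s\<ge>0. \<forall>t\<ge>0. \<forall>f. T (s + t) f = T s (T t f)) \<and>
     (\<forall>f. ((\<lambda>t. T t f) \<longlongrightarrow> f) (at_right 0))"

definition sep_limit ::
  "(real \<Rightarrow> ('e::metric_space \<Rightarrow>\<^sub>C real) \<Rightarrow> ('e \<Rightarrow>\<^sub>C real)) \<Rightarrow> 'e measure \<Rightarrow> real \<Rightarrow> real" where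
  "sep_limit T M t =
     (SUP (x, f) \<in> UNIV \<times> {f. \<forall>y. 0 < apply_bcontfun f y}.
        1 - apply_bcontfun (T t f) x / (\<integral>y. apply_bcontfun f y \<partial>M))"

end

theory Submission
  imports Defs
begin

text \<open>
  The generators \<open>gen n = c n (T n - 1)\<close> are intertwined by the down-steps, and
  \<open>gen n = c (n - 1) (D U - 1)\<close> for \<open>n \<ge> 1\<close>, where \<open>D\<close> and \<open>U\<close> are the down-step from
  level \<open>n\<close> and the up-step to level \<open>n\<close>. So the powers of \<open>T n\<close> are combinations, with
  nonnegative coefficients, of the operators that go down to level \<open>k\<close> and back up; for \<open>k = 0\<close>
  this operator is integration against the stationary distribution, and for \<open>k \<ge> 1\<close> it
  vanishes at \<open>(rr n, ss n)\<close>. Hence the pair \<open>(rr n, ss n)\<close> attains the separation distance.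

  The map \<open>g \<mapsto> \<Sum>s\<in>S n. g s \<cdot> d\<^sup>o\<^sub>s\<close> from functions on \<open>S n\<close> to \<open>C(E)\<close> is positive,
  compatible with the down-steps, and conjugates the semigroup of the chain to \<open>T\<close>. Since
  \<open>rr (n + 1)\<close> steps down to \<open>rr n\<close>, evaluation of the image of \<open>g\<close> at a limit point of
  \<open>\<iota> (rr m)\<close> gives \<open>g (rr n)\<close>, so nothing is lost in the supremum over \<open>E\<close>. The images of
  positive functions increase with \<open>n\<close> and are dense among the positive functions in \<open>C(E)\<close>.
\<close>

section \<open>Binomial sums, weighted sums and suprema\<close>

lemma binomial_step_sum:
  fixes a b :: real
  shows "(\<Sum>j\<le>Suc k. real (Suc k choose j) * a ^ j * b ^ (Suc k - j) * z j)
       = (\<Sum>j\<le>k. real (k choose j) * a ^ j * b ^ (k - j) * (a * z (Suc j) + b * z j))"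
proof -
  have "(\<Sum>j\<le>Suc k. real (Suc k choose j) * a ^ j * b ^ (Suc k - j) * z j)
      = b ^ Suc k * z 0 + (\<Sum>j\<le>k. real (Suc k choose Suc j) * a ^ Suc j * b ^ (k - j) * z (Suc j))"
    by (subst sum.atMost_Suc_shift) simp
  also have "\<dots> = b ^ Suc k * z 0 + (\<Sum>j\<le>k. real (k choose Suc j) * a ^ Suc j * b ^ (k - j) * z (Suc j))
      + (\<Sum>j\<le>k. real (k choose j) * a ^ j * b ^ (k - j) * (a * z (Suc j)))"
    by (simp add: sum.distrib[symmetric] algebra_simps)
  also have "b ^ Suc k * z 0 + (\<Sum>j\<le>k. real (k choose Suc j) * a ^ Suc j * b ^ (k - j) * z (Suc j))
      = (\<Sum>j\<le>Suc k. real (k choose j) * a ^ j * b ^ (Suc k - j) * z j)"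
    unfolding sum.atMost_Suc_shift by simp
  also have "\<dots> = (\<Sum>j\<le>k. real (k choose j) * a ^ j * b ^ (k - j) * (b * z j))"
    by (simp add: Suc_diff_le mult_ac)
  finally show ?thesis
    by (simp add: sum.distrib[symmetric] algebra_simps)
qed

lemma stochastic_nonneg: "stochastic A B P \<Longrightarrow> r \<in> A \<Longrightarrow> s \<in> B \<Longrightarrow> 0 \<le> P r s"
  and stochastic_sum: "stochastic A B P \<Longrightarrow> r \<in> A \<Longrightarrow> (\<Sum>s\<in>B. P r s) = 1"
  by (auto simp: stochastic_def)

lemma weighted_sum_pos:
  fixes w f :: "'a \<Rightarrow> real"
  assumes "finite A" "\<And>s. s \<in> A \<Longrightarrow> 0 \<le> w s" "sum w A = 1" "\<And>s. s \<in> A \<Longrightarrow> 0 < f s"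
  shows "0 < (\<Sum>s\<in>A. w s * f s)"
proof -
  obtain s where "s \<in> A" "w s \<noteq> 0"
    using assms(3) by (metis sum.neutral zero_neq_one)
  then have "0 < w s" using assms(2)[of s] by simp
  show ?thesis
    by (rule sum_pos2[OF assms(1) \<open>s \<in> A\<close>])
      (use \<open>0 < w s\<close> \<open>s \<in> A\<close> assms in \<open>auto intro!: mult_pos_pos mult_nonneg_nonneg less_imp_le[OF assms(4)]\<close>)
qed

lemma apply_bcontfun_sum: "apply_bcontfun (sum f A) x = (\<Sum>a\<in>A. apply_bcontfun (f a) x :: real)"
  by (induction A rule: infinite_finite_induct) auto

lemma apply_bcontfun_bounded_linear: "bounded_linear (\<lambda>f. apply_bcontfun f x :: real)"
  by (rule bounded_linear_intro[where K = 1]) (auto intro: norm_bounded simp del: real_norm_def)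

text \<open>The suprema below are approached along positive functions tending to an indicator, which
  in general is not positive itself; hence a limit in place of a maximum.\<close>

lemma cSup_eq_limit:
  fixes X :: "real set"
  assumes "\<And>x. x \<in> X \<Longrightarrow> x \<le> b" "\<And>k. h k \<in> X" "h \<longlonglongrightarrow> b"
  shows "Sup X = b"
proof (rule cSup_eq_non_empty)
  show "X \<noteq> {}" using assms(2) by blast
  show "b \<le> y" if "\<And>x. x \<in> X \<Longrightarrow> x \<le> y" for y
    using assms(3) by (rule LIMSEQ_le_const2) (use that assms(2) in auto)
qed (use assms in auto)

section \<open>The step operators and their products\<close>

locale up_down_chains =
  fixes S :: "nat \<Rightarrow> 's set" and e0 :: 's
    and pu pd :: "nat \<Rightarrow> 's \<Rightarrow> 's \<Rightarrow> real"
    and \<beta> c :: "nat \<Rightarrow> real"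
  assumes finite_S: "\<And>n. finite (S n)" and disjoint_S: "disjoint_family S" and S_0: "S 0 = {e0}"
    and stochastic_pu: "\<And>n. stochastic (S n) (S (Suc n)) (pu n)"
    and stochastic_pd: "\<And>n. n \<ge> 1 \<Longrightarrow> stochastic (S n) (S (n - 1)) (pd n)"
    and commutation: "\<And>n r s. n \<ge> 1 \<Longrightarrow> r \<in> S n \<Longrightarrow> s \<in> S n \<Longrightarrow>
           mat_mul (S (Suc n)) (pu n) (pd (Suc n)) r s
             = \<beta> n * mat_mul (S (n - 1)) (pd n) (pu (n - 1)) r s + (1 - \<beta> n) * mat_one r s"
    and beta_bounds: "\<And>n. n \<ge> 1 \<Longrightarrow> 0 < \<beta> n \<and> \<beta> n < 1"
    and c_pos: "\<And>n. 0 < c n"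
    and c_ratio: "\<And>n. n \<ge> 1 \<Longrightarrow> c (n - 1) / c n = \<beta> n"
begin

text \<open>Matrices act on functions from the left, so directions reverse: \<open>ustep n\<close>
  and \<open>up n m\<close> turn functions on the higher level into functions on level
  \<open>n\<close>, while \<open>dstep n\<close> and \<open>down m n\<close> turn functions on level
  \<open>n\<close> into functions on the higher level.\<close>

definition ustep :: "nat \<Rightarrow> ('s \<Rightarrow> real) \<Rightarrow> 's \<Rightarrow> real" where
  "ustep n f r = (\<Sum>s\<in>S (Suc n). pu n r s * f s)"

definition dstep :: "nat \<Rightarrow> ('s \<Rightarrow> real) \<Rightarrow> 's \<Rightarrow> real" where
  "dstep n f r = (\<Sum>s\<in>S n. pd (Suc n) r s * f s)"

definition up :: "nat \<Rightarrow> nat \<Rightarrow> ('s \<Rightarrow> real) \<Rightarrow> 's \<Rightarrow> real" where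
  "up n m f r = (\<Sum>s\<in>S m. up_prod S pu n m r s * f s)"

definition down :: "nat \<Rightarrow> nat \<Rightarrow> ('s \<Rightarrow> real) \<Rightarrow> 's \<Rightarrow> real" where
  "down m n f u = (\<Sum>s\<in>S n. down_prod S pd m n u s * f s)"

abbreviation "tr n \<equiv> trans_op S pu pd n"

definition gen :: "nat \<Rightarrow> ('s \<Rightarrow> real) \<Rightarrow> 's \<Rightarrow> real" where
  "gen n f r = c n * (tr n f r - f r)"

definition mean :: "nat \<Rightarrow> ('s \<Rightarrow> real) \<Rightarrow> real" where
  "mean n f = (\<Sum>u\<in>S n. f u * stat S pu e0 n u)"

text \<open>This is \<open>t\<close> times \<open>gen n\<close>, written out so that it agrees
  literally with the exponent in \<open>sep_chain\<close>.\<close>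

abbreviation tgen :: "real \<Rightarrow> nat \<Rightarrow> ('s \<Rightarrow> real) \<Rightarrow> 's \<Rightarrow> real" where
  "tgen t n \<equiv> (\<lambda>g u. t * c n * (tr n g u - g u))"

lemma level_eq: "s \<in> S n \<Longrightarrow> level S s = n"
  unfolding level_def using disjoint_S
  by (intro the_equality) (auto simp: disjoint_family_on_def)

lemma stochastic_pd': "stochastic (S (Suc n)) (S n) (pd (Suc n))"
  using stochastic_pd[of "Suc n"] by simp

lemma S_nonempty: "S n \<noteq> {}"
proof (induction n)
  case (Suc n)
  then obtain r where "r \<in> S n" by auto
  then show ?case using stochastic_sum[OF stochastic_pu, of r n] by auto
qed (simp add: S_0)

lemma ustep_cong: "(\<And>s. s \<in> S (Suc n) \<Longrightarrow> f s = g s) \<Longrightarrow> ustep n f r = ustep n g r"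
  by (simp add: ustep_def)

lemma dstep_cong: "(\<And>s. s \<in> S n \<Longrightarrow> f s = g s) \<Longrightarrow> dstep n f r = dstep n g r"
  by (simp add: dstep_def)

lemma up_cong: "(\<And>s. s \<in> S m \<Longrightarrow> f s = g s) \<Longrightarrow> up n m f r = up n m g r"
  by (simp add: up_def)

lemma down_cong: "(\<And>s. s \<in> S n \<Longrightarrow> f s = g s) \<Longrightarrow> down m n f r = down m n g r"
  by (simp add: down_def)

lemma tr_cong: "(\<And>s. s \<in> S n \<Longrightarrow> f s = g s) \<Longrightarrow> tr n f r = tr n g r"
  by (simp add: trans_op_def)

lemma gen_cong: "(\<And>s. s \<in> S n \<Longrightarrow> f s = g s) \<Longrightarrow> r \<in> S n \<Longrightarrow> gen n f r = gen n g r"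
  by (simp add: gen_def cong: tr_cong)

lemma sum_mat_one_left: "finite A \<Longrightarrow> r \<in> A \<Longrightarrow> (\<Sum>s\<in>A. mat_one r s * f s) = (f r :: real)"
  by (simp add: mat_one_def if_distrib[of "\<lambda>x. x * _"] cong: if_cong)

lemma sum_mat_mul: "(\<Sum>s\<in>A. mat_mul B P Q r s * f s) = (\<Sum>u\<in>B. P r u * (\<Sum>s\<in>A. Q u s * f s))"
  unfolding mat_mul_def sum_distrib_right sum_distrib_left
  by (subst sum.swap) (simp add: mult.assoc)

lemma up_same: "r \<in> S n \<Longrightarrow> up n n f r = f r"
  unfolding up_def using finite_S by (cases n) (simp_all add: sum_mat_one_left)

lemma up_Suc: "n \<le> m \<Longrightarrow> up n (Suc m) f r = up n m (ustep m f) r"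
  by (simp add: up_def ustep_def sum_mat_mul)

text \<open>\<open>up_prod\<close> is recursive in its last factor; induction allows the first one
  to be split off as well.\<close>

lemma up_ustep: "n < m \<Longrightarrow> r \<in> S n \<Longrightarrow> ustep n (up (Suc n) m f) r = up n m f r"
proof (induction m arbitrary: f)
  case (Suc m)
  show ?case
  proof (cases "n = m")
    case True
    show ?thesis using Suc.prems
      unfolding True by (simp add: up_Suc up_same cong: ustep_cong)
  next
    case False
    then show ?thesis using Suc by (simp add: up_Suc)
  qed
qed simp

lemma down_same: "r \<in> S n \<Longrightarrow> down n n f r = f r"
  unfolding down_def using finite_S by (cases n) (simp_all add: sum_mat_one_left)

lemma down_Suc: "n \<le> m \<Longrightarrow> down (Suc m) n f r = dstep m (down m n f) r"
  by (simp add: down_def dstep_def sum_mat_mul)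

lemma down_dstep: "n < m \<Longrightarrow> r \<in> S m \<Longrightarrow> down m (Suc n) (dstep n f) r = down m n f r"
proof (induction m arbitrary: r)
  case (Suc m)
  show ?case
  proof (cases "n = m")
    case True
    show ?thesis using Suc.prems
      unfolding True by (simp add: down_Suc down_same cong: dstep_cong)
  next
    case False
    then show ?thesis using Suc by (simp add: down_Suc cong: dstep_cong)
  qed
qed simp

lemma down_down: "n \<le> k \<Longrightarrow> k \<le> m \<Longrightarrow> r \<in> S m \<Longrightarrow> down m k (down k n f) r = down m n f r"
proof (induction m arbitrary: r)
  case 0
  then show ?case by (simp add: down_same)
next
  case (Suc m)
  show ?case
  proof (cases "k = Suc m")
    case True
    then show ?thesis using Suc.prems by (simp add: down_same)
  next
    case False
    then show ?thesis using Suc by (simp add: down_Suc cong: dstep_cong)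
  qed
qed

lemma dstep_pos: "(\<And>s. s \<in> S n \<Longrightarrow> 0 < f s) \<Longrightarrow> r \<in> S (Suc n) \<Longrightarrow> 0 < dstep n f r"
  unfolding dstep_def using stochastic_pd'[of n] finite_S
  by (intro weighted_sum_pos) (auto simp: stochastic_def)

lemma dstep_nonneg: "(\<And>s. s \<in> S n \<Longrightarrow> 0 \<le> f s) \<Longrightarrow> r \<in> S (Suc n) \<Longrightarrow> 0 \<le> dstep n f r"
  unfolding dstep_def using stochastic_pd'[of n]
  by (intro sum_nonneg) (auto simp: stochastic_def)

lemma ustep_nonneg: "(\<And>s. s \<in> S (Suc n) \<Longrightarrow> 0 \<le> f s) \<Longrightarrow> r \<in> S n \<Longrightarrow> 0 \<le> ustep n f r"
  unfolding ustep_def using stochastic_pu[of n]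
  by (intro sum_nonneg) (auto simp: stochastic_def)

lemma dstep_const: "r \<in> S (Suc n) \<Longrightarrow> dstep n (\<lambda>_. a) r = a"
  using stochastic_sum[OF stochastic_pd'] by (simp add: dstep_def sum_distrib_right[symmetric])

lemma ustep_const: "r \<in> S n \<Longrightarrow> ustep n (\<lambda>_. a) r = a"
  using stochastic_sum[OF stochastic_pu] by (simp add: ustep_def sum_distrib_right[symmetric])

lemma down_nonneg: "n \<le> m \<Longrightarrow> (\<And>s. s \<in> S n \<Longrightarrow> 0 \<le> f s) \<Longrightarrow> r \<in> S m \<Longrightarrow> 0 \<le> down m n f r"
proof (induction m arbitrary: r)
  case (Suc m)
  then show ?case
    by (cases "n = Suc m") (auto simp: down_same down_Suc intro!: dstep_nonneg)
qed (simp add: down_same)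

lemma down_const: "n \<le> m \<Longrightarrow> r \<in> S m \<Longrightarrow> down m n (\<lambda>_. a) r = a"
proof (induction m arbitrary: r)
  case (Suc m)
  then show ?case
    by (cases "n = Suc m") (auto simp: down_same down_Suc dstep_const cong: dstep_cong)
qed (simp add: down_same)

lemma up_nonneg: "n \<le> m \<Longrightarrow> (\<And>s. s \<in> S m \<Longrightarrow> 0 \<le> f s) \<Longrightarrow> r \<in> S n \<Longrightarrow> 0 \<le> up n m f r"
proof (induction m arbitrary: f)
  case (Suc m)
  then show ?case
    by (cases "n = Suc m") (auto simp: up_same up_Suc intro!: Suc.IH ustep_nonneg)
qed (simp add: up_same)

lemma up_const: "n \<le> m \<Longrightarrow> r \<in> S n \<Longrightarrow> up n m (\<lambda>_. a) r = a"
proof (induction m)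
  case (Suc m)
  then show ?case
    by (cases "n = Suc m") (auto simp: up_same up_Suc ustep_const cong: up_cong)
qed (simp add: up_same)

lemma down_sum: "down m n (\<lambda>u. \<Sum>i\<in>I. a i * g i u) r = (\<Sum>i\<in>I. a i * down m n (g i) r)"
  unfolding down_def sum_distrib_left by (subst sum.swap) (simp add: mult_ac)

lemma tr_sum: "tr n (\<lambda>u. \<Sum>i\<in>I. a i * g i u) r = (\<Sum>i\<in>I. a i * tr n (g i) r)"
  unfolding trans_op_def sum_distrib_left by (subst sum.swap) (simp add: mult_ac)

lemma gen_sum: "gen n (\<lambda>u. \<Sum>i\<in>I. a i * g i u) r = (\<Sum>i\<in>I. a i * gen n (g i) r)"
  by (simp add: gen_def tr_sum sum_subtractf sum_distrib_left algebra_simps)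

subsection \<open>Intertwining of the generators\<close>

lemma tr_eq: "tr n f r = ustep n (dstep n f) r"
  by (simp add: trans_op_def trans_mat_def ustep_def dstep_def sum_mat_mul)

lemma c_Suc: "c n = \<beta> (Suc n) * c (Suc n)"
  using c_ratio[of "Suc n"] c_pos[of "Suc n"] by (simp add: field_simps)

lemma c_less_Suc: "c n < c (Suc n)"
  using beta_bounds[of "Suc n"] c_pos[of "Suc n"] by (simp add: c_Suc[of n])

lemma c_strict_mono: "m < n \<Longrightarrow> c m < c n"
  by (rule lift_Suc_mono_less[of c, OF c_less_Suc])

lemma c_prev_0 [simp]: "c_prev c 0 = 0" and c_prev_Suc [simp]: "c_prev c (Suc n) = c n"
  by (simp_all add: c_prev_def)

lemma c_prev_less: "k \<le> n \<Longrightarrow> c_prev c k < c n"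
  by (cases k) (use c_pos c_strict_mono in auto)

lemma c_prev_strict_mono: "j < k \<Longrightarrow> c_prev c j < c_prev c k"
  by (cases k) (use c_prev_less[of j] in auto)

lemma gen_0: "r \<in> S 0 \<Longrightarrow> gen 0 f r = 0"
proof -
  assume r: "r \<in> S 0"
  then have "tr 0 f r = ustep 0 (dstep 0 (\<lambda>_. f e0)) r"
    unfolding tr_eq by (intro ustep_cong dstep_cong) (simp add: S_0)
  also have "\<dots> = f e0"
    using r by (simp add: dstep_const ustep_const cong: ustep_cong)
  finally show ?thesis using r by (simp add: gen_def S_0)
qed

text \<open>The commutation relation turns \<open>T - 1\<close> on level \<open>Suc n\<close> into
  \<open>\<beta> (Suc n)\<close> times \<open>D U - 1\<close>, and
  \<open>c (Suc n) * \<beta> (Suc n) = c n\<close>.\<close>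

lemma gen_Suc:
  assumes "r \<in> S (Suc n)"
  shows "gen (Suc n) f r = c n * (dstep n (ustep n f) r - f r)"
proof -
  have "tr (Suc n) f r = (\<Sum>s\<in>S (Suc n). \<beta> (Suc n) * (mat_mul (S n) (pd (Suc n)) (pu n) r s * f s)
          + (1 - \<beta> (Suc n)) * (mat_one r s * f s))"
    unfolding trans_op_def trans_mat_def
    by (intro sum.cong refl, subst commutation) (use assms in \<open>auto simp: algebra_simps\<close>)
  also have "\<dots> = \<beta> (Suc n) * dstep n (ustep n f) r + (1 - \<beta> (Suc n)) * f r"
    using assms finite_S
    by (simp add: sum.distrib sum_distrib_left[symmetric] sum_mat_mul sum_mat_one_left
        dstep_def ustep_def)
  finally have tr: "tr (Suc n) f r = \<dots>" .
  show ?thesis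
    unfolding gen_def tr c_Suc[of n] by (simp add: algebra_simps)
qed

text \<open>Associativity: \<open>(D U - 1) D = D (U D - 1)\<close>, where \<open>U D\<close> is the
  transition operator of level \<open>n\<close>. Both descriptions of the generators carry the same
  constant \<open>c n\<close>.\<close>

lemma gen_dstep:
  assumes "r \<in> S (Suc n)"
  shows "gen (Suc n) (dstep n f) r = dstep n (gen n f) r"
proof -
  have "gen (Suc n) (dstep n f) r = c n * (dstep n (tr n f) r - dstep n f r)"
    using assms by (simp add: gen_Suc tr_eq dstep_def)
  also have "\<dots> = dstep n (gen n f) r"
    by (simp add: dstep_def gen_def sum_subtractf[symmetric] sum_distrib_left algebra_simps)
  finally show ?thesis .
qed

lemma gen_down: "n \<le> m \<Longrightarrow> r \<in> S m \<Longrightarrow> gen m (down m n f) r = down m n (gen n f) r"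
proof (induction m arbitrary: r)
  case 0
  then show ?case by (simp add: down_same gen_0)
next
  case (Suc m)
  show ?case
  proof (cases "n = Suc m")
    case True
    show ?thesis using Suc.prems unfolding True by (simp add: down_same cong: gen_cong)
  next
    case False
    then show ?thesis using Suc
      by (simp add: down_Suc gen_dstep cong: gen_cong dstep_cong)
  qed
qed

section \<open>The operators that go down to level \<open>k\<close> and back up\<close>

definition du :: "nat \<Rightarrow> nat \<Rightarrow> ('s \<Rightarrow> real) \<Rightarrow> 's \<Rightarrow> real" where
  "du n k f = down n k (up k n f)"

lemma du_same: "r \<in> S n \<Longrightarrow> du n n f r = f r"
  by (simp add: du_def down_same up_same)

lemma du_nonneg: "k \<le> n \<Longrightarrow> (\<And>s. s \<in> S n \<Longrightarrow> 0 \<le> f s) \<Longrightarrow> r \<in> S n \<Longrightarrow> 0 \<le> du n k f r"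
  unfolding du_def by (intro down_nonneg up_nonneg)

lemma mean_eq: "mean n f = up 0 n f e0"
  by (simp add: up_def mean_def stat_def mult.commute)

lemma du_0: "r \<in> S n \<Longrightarrow> du n 0 f r = mean n f"
proof -
  assume "r \<in> S n"
  then show ?thesis
    unfolding du_def mean_eq by (subst down_cong[where g = "\<lambda>_. up 0 n f e0"]) (auto simp: S_0 down_const)
qed

lemma gen_du_0: "r \<in> S n \<Longrightarrow> gen n (du n 0 f) r = 0"
  unfolding du_def by (subst gen_down) (auto simp: gen_0 down_const cong: down_cong)

text \<open>Intertwining moves the generator to level \<open>Suc k\<close>, where it is
  \<open>c k\<close> times \<open>D U - 1\<close>; the extra \<open>D\<close> and \<open>U\<close>
  extend the excursion down to level \<open>k\<close>.\<close>

lemma gen_du_Suc: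
  assumes "k < n" "r \<in> S n"
  shows "gen n (du n (Suc k) f) r = c k * (du n k f r - du n (Suc k) f r)"
proof -
  have "gen n (du n (Suc k) f) r
      = down n (Suc k) (\<lambda>s. c k * (dstep k (ustep k (up (Suc k) n f)) s - up (Suc k) n f s)) r"
    unfolding du_def using assms by (subst gen_down) (auto simp: gen_Suc cong: down_cong)
  also have "\<dots> = c k * (down n (Suc k) (dstep k (ustep k (up (Suc k) n f))) r
                  - down n (Suc k) (up (Suc k) n f) r)"
    by (simp add: down_def sum_subtractf[symmetric] sum_distrib_left algebra_simps)
  also have "\<dots> = c k * (du n k f r - du n (Suc k) f r)"
    using assms by (simp add: down_dstep du_def up_ustep cong: down_cong)
  finally show ?thesis .
qed

text \<open>On combinations of the \<open>du n k f\<close> the generator acts by a bidiagonal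
  matrix. Both the recursion of \<open>pcoef\<close> and the eigenfunctions come from this
  formula.\<close>

lemma gen_du_sum:
  assumes "r \<in> S n"
  shows "gen n (\<lambda>u. \<Sum>k\<le>n. a k * du n k f u) r
    = (\<Sum>k<n. a (Suc k) * c k * du n k f r) - (\<Sum>k\<le>n. a k * c_prev c k * du n k f r)"
proof -
  have "gen n (\<lambda>u. \<Sum>k\<le>n. a k * du n k f u) r = (\<Sum>k\<in>{..<Suc n}. a k * gen n (du n k f) r)"
    by (simp add: gen_sum lessThan_Suc_atMost)
  also have "\<dots> = (\<Sum>k<n. a (Suc k) * (c k * (du n k f r - du n (Suc k) f r)))"
    unfolding sum.lessThan_Suc_shift using assms by (simp add: gen_du_0 gen_du_Suc)
  also have "\<dots> = (\<Sum>k<n. a (Suc k) * c k * du n k f r)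
      - (\<Sum>k<Suc n. a k * c_prev c k * du n k f r)"
    unfolding sum.lessThan_Suc_shift by (simp add: sum_subtractf algebra_simps)
  finally show ?thesis by (simp add: lessThan_Suc_atMost)
qed

lemma mean_const: "mean n (\<lambda>_. a) = a"
  using S_nonempty[of n] du_0[of _ n "\<lambda>_. a"]
  by (auto simp: du_def up_const down_const cong: down_cong)

lemma stat_nonneg: "s \<in> S n \<Longrightarrow> 0 \<le> stat S pu e0 n s"
proof -
  assume s: "s \<in> S n"
  have "stat S pu e0 n s = up 0 n (\<lambda>u. if u = s then 1 else 0) e0"
    using s finite_S by (simp add: stat_def up_def if_distrib[of "\<lambda>x. _ * x"] cong: if_cong)
  then show ?thesis by (simp add: up_nonneg S_0)
qed

lemma mean_pos: "(\<And>u. u \<in> S n \<Longrightarrow> 0 < f u) \<Longrightarrow> 0 < mean n f"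
  using weighted_sum_pos[of "S n" "stat S pu e0 n" f] mean_const[of n 1] finite_S stat_nonneg
  by (simp add: mean_def mult.commute)

subsection \<open>Powers of the transition operator\<close>

text \<open>The recursion is \<open>tr n = 1 + gen n / c n\<close> read through
  \<open>gen_du_sum\<close>. For \<open>k \<le> n\<close> it gives the law at time \<open>m\<close>
  of a chain started at \<open>n\<close> that jumps from \<open>k\<close> to \<open>k - 1\<close>
  with probability \<open>c_prev c k / c n\<close> and otherwise stays.\<close>

primrec pcoef :: "nat \<Rightarrow> nat \<Rightarrow> nat \<Rightarrow> real" where
  "pcoef n 0 k = (if k = n then 1 else 0)"
| "pcoef n (Suc m) k = (1 - c_prev c k / c n) * pcoef n m k + c k / c n * pcoef n m (Suc k)"

lemma pcoef_above: "n < k \<Longrightarrow> pcoef n m k = 0"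
  by (induction m arbitrary: k) auto

lemma pcoef_nonneg: "0 \<le> pcoef n m k"
proof (induction m arbitrary: k)
  case (Suc m)
  show ?case
  proof (cases "k \<le> n")
    case True
    then have "c_prev c k / c n \<le> 1" using c_prev_less[of k n] c_pos[of n] by simp
    then show ?thesis using Suc c_pos[THEN less_imp_le] by (auto intro!: add_nonneg_nonneg mult_nonneg_nonneg)
  next
    \<comment> \<open>Above level \<open>n\<close> the factor \<open>1 - c_prev c k / c n\<close>
      may be negative, but the coefficient is 0.\<close>
    case False
    then show ?thesis using pcoef_above[of n k "Suc m"] by simp
  qed
qed simp

text \<open>The chain described by \<open>pcoef\<close> reaches \<open>n - m\<close> by
  \<open>m\<close> consecutive jumps, each of positive probability.\<close>

lemma pcoef_diag: "m \<le> n \<Longrightarrow> 0 < pcoef n m (n - m)"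
proof (induction m)
  case (Suc m)
  have "c_prev c (n - Suc m) / c n \<le> 1" using c_prev_less[of "n - Suc m" n] c_pos[of n] by simp
  moreover have "0 < c (n - Suc m) / c n * pcoef n m (Suc (n - Suc m))"
    using Suc c_pos by (simp add: Suc_diff_Suc)
  ultimately show ?case
    using pcoef_nonneg[of n m "n - Suc m"] by (auto intro!: add_nonneg_pos mult_nonneg_nonneg)
qed simp

lemma tr_pow_eq:
  "r \<in> S n \<Longrightarrow> (tr n ^^ m) f r = (\<Sum>k\<le>n. pcoef n m k * du n k f r)"
proof (induction m arbitrary: r)
  case 0
  then show ?case using finite_S
    by (simp add: du_same if_distrib[of "\<lambda>x. x * _"] cong: if_cong)
next
  case (Suc m)
  let ?g = "\<lambda>u. \<Sum>k\<le>n. pcoef n m k * du n k f u"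
  have "(tr n ^^ Suc m) f r = tr n ?g r"
    unfolding funpow.simps o_apply by (rule tr_cong) (rule Suc.IH)
  also have "\<dots> = ?g r + gen n ?g r / c n"
    using c_pos[of n] by (simp add: gen_def)
  \<comment> \<open>The first sum may run up to \<open>k = n\<close> because
    \<open>pcoef n m (Suc n) = 0\<close>.\<close>
  also have "\<dots> = ?g r + ((\<Sum>k\<le>n. pcoef n m (Suc k) * c k * du n k f r)
       - (\<Sum>k\<le>n. pcoef n m k * c_prev c k * du n k f r)) / c n"
    using gen_du_sum[OF Suc.prems, of "pcoef n m" f] sum.lessThan_Suc[of "\<lambda>k. pcoef n m (Suc k) * c k * du n k f r" n]
    by (simp add: lessThan_Suc_atMost pcoef_above)
  also have "\<dots> = (\<Sum>k\<le>n. pcoef n (Suc m) k * du n k f r)"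
    by (simp add: sum_divide_distrib diff_divide_distrib sum_subtractf[symmetric] sum.distrib[symmetric] algebra_simps)
  finally show ?case .
qed

lemma tr_pow_mat_pow:
  "r \<in> S n \<Longrightarrow> (\<Sum>s\<in>S n. mat_pow (S n) (trans_mat S pu pd n) m r s * f s) = (tr n ^^ m) f r"
  by (induction m arbitrary: f)
    (simp_all add: sum_mat_one_left finite_S sum_mat_mul trans_op_def[symmetric] funpow_swap1)

definition point :: "'s \<Rightarrow> 's \<Rightarrow> real" where
  "point s u = (if u = s then 1 else 0)"

lemma sum_point: "finite A \<Longrightarrow> s \<in> A \<Longrightarrow> (\<Sum>u\<in>A. f u * point s u) = f s"
  by (simp add: point_def if_distrib[of "\<lambda>x. _ * x"] cong: if_cong)

lemma mat_pow_eq: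
  "r \<in> S n \<Longrightarrow> s \<in> S n \<Longrightarrow> mat_pow (S n) (trans_mat S pu pd n) m r s = (tr n ^^ m) (point s) r"
  using tr_pow_mat_pow[of r n m "point s"] by (simp add: sum_point finite_S)

lemma mean_point: "s \<in> S n \<Longrightarrow> mean n (point s) = stat S pu e0 n s"
  using sum_point[of "S n" s "stat S pu e0 n"] by (simp add: mean_def finite_S mult.commute)

text \<open>If \<open>s\<close> is not reachable from \<open>r\<close> in fewer than \<open>n\<close> steps, the nonnegative terms
  \<open>du n k\<close> with \<open>k \<ge> 1\<close> all vanish at \<open>(r, s)\<close>, so the pair \<open>(r, s)\<close> is extremal.\<close>

lemma tr_pow_lower_bound:
  assumes rs: "r \<in> S n" "s \<in> S n"
    and far: "\<And>m. m < n \<Longrightarrow> (tr n ^^ m) (point s) r = 0"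
    and f: "\<And>u. u \<in> S n \<Longrightarrow> 0 \<le> f u" and u: "u \<in> S n" and pos: "0 < stat S pu e0 n s"
  shows "(tr n ^^ m) (point s) r / stat S pu e0 n s * mean n f \<le> (tr n ^^ m) f u"
proof -
  have point: "0 \<le> du n k (point s) r" if "k \<le> n" for k
    using that rs by (intro du_nonneg) (auto simp: point_def)
  have vanish: "du n k (point s) r = 0" if k: "0 < k" "k \<le> n" for k
  proof -
    \<comment> \<open>The exponent \<open>n - k\<close> is below \<open>n\<close> as
      \<open>k > 0\<close>, and it is the one at which \<open>du n k\<close> first has a positive
      coefficient.\<close>
    have "(\<Sum>j\<le>n. pcoef n (n - k) j * du n j (point s) r) = 0"
      using far[of "n - k"] k rs by (simp add: tr_pow_eq)
    then have "pcoef n (n - k) k * du n k (point s) r = 0"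
      using k point pcoef_nonneg by (subst (asm) sum_nonneg_eq_0_iff) auto
    then show ?thesis using pcoef_diag[of "n - k" n] k by simp
  qed
  have "(tr n ^^ m) (point s) r = pcoef n m 0 * stat S pu e0 n s"
  proof -
    have "(tr n ^^ m) (point s) r = (\<Sum>k\<in>{0}. pcoef n m k * du n k (point s) r)"
      unfolding tr_pow_eq[OF rs(1)] using vanish by (intro sum.mono_neutral_right) auto
    then show ?thesis using rs by (simp add: du_0 mean_point)
  qed
  then have "(tr n ^^ m) (point s) r / stat S pu e0 n s * mean n f = pcoef n m 0 * du n 0 f u"
    using pos u by (simp add: du_0)
  also have "\<dots> \<le> (\<Sum>k\<le>n. pcoef n m k * du n k f u)"
    using u f pcoef_nonneg by (intro member_le_sum) (auto intro!: mult_nonneg_nonneg du_nonneg)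
  finally show ?thesis by (simp add: tr_pow_eq[OF u])
qed

subsection \<open>The semigroups of the chains\<close>

abbreviation heat :: "nat \<Rightarrow> real \<Rightarrow> ('s \<Rightarrow> real) \<Rightarrow> 's \<Rightarrow> real" where
  "heat n t \<equiv> op_exp (tgen t n)"

text \<open>Binomial theorem for \<open>x T - x\<close>, \<open>x = t * c n\<close>, with Pascal's
  rule from \<open>binomial_step_sum\<close>. The powers of \<open>x\<close> and \<open>- x\<close>
  stay apart to match a Cauchy product of exponential series.\<close>

lemma tgen_pow:
  "(tgen t n ^^ k) f r
     = (\<Sum>j\<le>k. real (k choose j) * (t * c n) ^ j * (- (t * c n)) ^ (k - j) * (tr n ^^ j) f r)"
proof (induction k arbitrary: f)
  case (Suc k)
  have tr_lin: "tr n (\<lambda>u. a * (g u - h u)) = (\<lambda>r. a * (tr n g r - tr n h r))" for a g h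
    by (simp add: fun_eq_iff trans_op_def sum_subtractf[symmetric] sum_distrib_left algebra_simps)
  have lin: "(tr n ^^ j) (\<lambda>u. a * (g u - h u)) = (\<lambda>r. a * ((tr n ^^ j) g r - (tr n ^^ j) h r))" for j a g h
    by (induction j) (simp_all add: tr_lin)
  show ?case
    unfolding funpow_Suc_right o_apply Suc.IH binomial_step_sum lin
    by (intro sum.cong refl) (simp add: funpow_swap1 algebra_simps)
qed simp

text \<open>A positive operator that fixes constants is a contraction in the sup norm: apply it to
  \<open>K - g\<close> and \<open>K + g\<close>.\<close>

lemma tr_pow_bound:
  assumes "\<And>u. u \<in> S n \<Longrightarrow> \<bar>f u\<bar> \<le> K" "r \<in> S n"
  shows "\<bar>(tr n ^^ m) f r\<bar> \<le> K"
proof -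
  have pt: "\<bar>tr n g r\<bar> \<le> K" if g: "\<And>u. u \<in> S n \<Longrightarrow> \<bar>g u\<bar> \<le> K" and r: "r \<in> S n" for g r
  proof -
    have nn: "0 \<le> tr n h r" if "\<And>u. u \<in> S n \<Longrightarrow> 0 \<le> h u" for h
      unfolding tr_eq using that r by (intro ustep_nonneg dstep_nonneg)
    have K: "tr n (\<lambda>_. K) r = K"
      unfolding tr_eq using r by (simp add: dstep_const ustep_const cong: ustep_cong)
    have "tr n (\<lambda>u. K - g u) r = K - tr n g r" "tr n (\<lambda>u. K + g u) r = K + tr n g r"
      using K by (simp_all add: trans_op_def sum_subtractf sum.distrib algebra_simps)
    moreover have "0 \<le> tr n (\<lambda>u. K - g u) r" "0 \<le> tr n (\<lambda>u. K + g u) r"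
      using g by (auto intro!: nn simp: abs_le_iff) (smt (verit, ccfv_SIG))+
    ultimately show ?thesis by linarith
  qed
  show ?thesis using assms(2)
    by (induction m arbitrary: r) (simp_all add: assms(1) pt)
qed

lemma heat_summable:
  assumes r: "r \<in> S n"
  shows "summable (\<lambda>m. \<bar>(t * c n) ^ m * (tr n ^^ m) f r / fact m\<bar>)"
proof -
  define K where "K = (\<Sum>u\<in>S n. \<bar>f u\<bar>)"
  have K: "\<bar>(tr n ^^ m) f r\<bar> \<le> K" for m
    using r finite_S[of n] unfolding K_def by (intro tr_pow_bound member_le_sum) auto
  have "summable (\<lambda>m. K * (inverse (fact m) * \<bar>t * c n\<bar> ^ m))"
    by (intro summable_mult summable_exp)
  then show ?thesis
  proof (rule summable_comparison_test[rotated], intro exI allI impI)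
    fix m
    show "norm \<bar>(t * c n) ^ m * (tr n ^^ m) f r / fact m\<bar> \<le> K * (inverse (fact m) * \<bar>t * c n\<bar> ^ m)"
      using mult_right_mono[OF K[of m], of "\<bar>t * c n\<bar> ^ m / fact m"]
      by (simp add: abs_mult power_abs field_simps)
  qed
qed

text \<open>Uniformization: the factor \<open>exp (- t * c n)\<close> is split off so that only nonnegative
  powers of the transition operator remain.\<close>

lemma
  assumes r: "r \<in> S n"
  shows heat_sums: "(\<lambda>k. (tgen t n ^^ k) f r / fact k) sums heat n t f r"
    and heat_eq: "heat n t f r = (\<Sum>m. (t * c n) ^ m * (tr n ^^ m) f r / fact m) * exp (- (t * c n))"
proof -
  let ?a = "\<lambda>m. (t * c n) ^ m * (tr n ^^ m) f r / fact m"
  let ?b = "\<lambda>m. (- (t * c n)) ^ m / fact m"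
  \<comment> \<open>The Cauchy product of the series of \<open>exp (x T)\<close> and
    \<open>exp (- x)\<close>, \<open>x = t * c n\<close>, is the series defining
    \<open>heat\<close>.\<close>
  have eq: "(\<Sum>i\<le>k. ?a i * ?b (k - i)) = (tgen t n ^^ k) f r / fact k" for k
    unfolding tgen_pow sum_divide_distrib
    by (intro sum.cong refl) (simp add: binomial_fact field_simps)
  have "?b sums exp (- (t * c n))"
    using exp_converges[of "- (t * c n)"] by (simp add: field_simps)
  then have b: "(\<Sum>m. ?b m) = exp (- (t * c n))" by (rule sums_unique[symmetric])
  have "summable (\<lambda>m. norm (?b m))"
    using summable_norm_exp[of "- (t * c n)"] by (simp add: field_simps)
  then have "(\<lambda>k. (tgen t n ^^ k) f r / fact k) sums ((\<Sum>m. ?a m) * exp (- (t * c n)))"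
    using Cauchy_product_sums[of ?a ?b] heat_summable[OF r, of t f] unfolding eq b by simp
  then show "(\<lambda>k. (tgen t n ^^ k) f r / fact k) sums heat n t f r"
    and "heat n t f r = (\<Sum>m. ?a m) * exp (- (t * c n))"
    unfolding op_exp_def by (auto simp: sums_iff)
qed

lemma heat_cong:
  assumes "\<And>u. u \<in> S n \<Longrightarrow> f u = g u" "r \<in> S n"
  shows "heat n t f r = heat n t g r"
proof -
  have "(tgen t n ^^ k) f r = (tgen t n ^^ k) g r" for k
    using assms(2) by (induction k arbitrary: r) (simp_all add: assms(1) cong: tr_cong)
  then show ?thesis by (simp add: op_exp_def)
qed

lemma heat_sum:
  assumes r: "r \<in> S n"
  shows "heat n t (\<lambda>u. \<Sum>i\<in>I. a i * g i u) r = (\<Sum>i\<in>I. a i * heat n t (g i) r)"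
proof -
  have "(tgen t n ^^ k) (\<lambda>u. \<Sum>i\<in>I. a i * g i u) = (\<lambda>r. \<Sum>i\<in>I. a i * (tgen t n ^^ k) (g i) r)" for k
    by (induction k) (simp_all add: tr_sum sum_subtractf[symmetric] sum_distrib_left algebra_simps)
  moreover have "(\<lambda>k. \<Sum>i\<in>I. a i * ((tgen t n ^^ k) (g i) r / fact k)) sums (\<Sum>i\<in>I. a i * heat n t (g i) r)"
    by (intro sums_sum sums_mult heat_sums r)
  ultimately show ?thesis
    using heat_sums[OF r, of t "\<lambda>u. \<Sum>i\<in>I. a i * g i u"]
    by (intro sums_unique2) (simp_all add: sum_divide_distrib)
qed

lemma heat_eigen:
  assumes eig: "\<And>u. u \<in> S n \<Longrightarrow> gen n w u = - l * w u" and r: "r \<in> S n"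
  shows "heat n t w r = exp (- t * l) * w r"
proof -
  have pow: "(tgen t n ^^ k) w u = (- t * l) ^ k * w u" if "u \<in> S n" for u k
    using that
  proof (induction k arbitrary: u)
    case (Suc k)
    have "(tgen t n ^^ Suc k) w u = tgen t n (\<lambda>v. (- t * l) ^ k * w v) u"
      using Suc by (simp cong: tr_cong)
    also have "\<dots> = (- t * l) ^ k * (t * gen n w u)"
      by (simp add: gen_def trans_op_def sum_distrib_left algebra_simps)
    finally show ?case using eig[OF Suc.prems] by simp
  qed simp
  have "(\<lambda>k. (- t * l) ^ k /\<^sub>R fact k * w r) sums (exp (- t * l) * w r)"
    by (intro sums_mult2 exp_converges)
  then have "(\<lambda>k. (tgen t n ^^ k) w r / fact k) sums (exp (- t * l) * w r)"
    unfolding pow[OF r] by (simp add: field_simps)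
  then show ?thesis
    by (rule sums_unique2[OF heat_sums[OF r]])
qed

lemma heat_down:
  assumes "n \<le> m" "r \<in> S m"
  shows "heat m t (down m n f) r = down m n (heat n t f) r"
proof -
  have pow: "(tgen t m ^^ k) (down m n f) u = down m n ((tgen t n ^^ k) f) u" if "u \<in> S m" for u k
    using that
  proof (induction k arbitrary: u)
    case (Suc k)
    have "(tgen t m ^^ Suc k) (down m n f) u = t * gen m (down m n ((tgen t n ^^ k) f)) u"
      using Suc by (simp add: gen_def cong: tr_cong)
    also have "\<dots> = t * down m n (gen n ((tgen t n ^^ k) f)) u"
      using assms Suc.prems by (simp add: gen_down)
    also have "\<dots> = down m n ((tgen t n ^^ Suc k) f) u"
      by (simp add: gen_def down_def sum_distrib_left algebra_simps)
    finally show ?case .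
  qed simp
  have "(\<lambda>k. \<Sum>s\<in>S n. down_prod S pd m n r s * ((tgen t n ^^ k) f s / fact k)) sums down m n (heat n t f) r"
    unfolding down_def by (intro sums_sum sums_mult heat_sums)
  then show ?thesis
    using heat_sums[OF assms(2), of t "down m n f"] pow[OF assms(2)]
    by (intro sums_unique2) (simp_all add: down_def sum_divide_distrib)
qed

text \<open>The bound for powers is summed with the weights \<open>(t * c n) ^ m / fact m\<close>,
  which are nonnegative for \<open>t \<ge> 0\<close>.\<close>

lemma heat_lower_bound:
  assumes rs: "r \<in> S n" "s \<in> S n"
    and far: "\<And>m. m < n \<Longrightarrow> (tr n ^^ m) (point s) r = 0"
    and f: "\<And>u. u \<in> S n \<Longrightarrow> 0 \<le> f u" and u: "u \<in> S n" and pos: "0 < stat S pu e0 n s" and t: "0 \<le> t"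
  shows "heat n t (point s) r / stat S pu e0 n s * mean n f \<le> heat n t f u"
proof -
  let ?a = "\<lambda>g v m. (t * c n) ^ m * (tr n ^^ m) g v / fact m"
  have s: "summable (?a g v)" if "v \<in> S n" for g v
    using heat_summable[OF that, of t g] by (simp add: summable_rabs_cancel)
  have le: "?a (point s) r m * (mean n f / stat S pu e0 n s) \<le> ?a f u m" for m
    using mult_left_mono[OF tr_pow_lower_bound[where m = m, OF rs far f u pos],
      where c = "(t * c n) ^ m / fact m"]
      t c_pos[of n] by (simp add: field_simps)
  have "(\<Sum>m. ?a (point s) r m) * (mean n f / stat S pu e0 n s) \<le> (\<Sum>m. ?a f u m)"
    unfolding suminf_mult2[OF s[OF rs(1)]]
    by (intro suminf_le le summable_mult2 s rs u)
  then have "(\<Sum>m. ?a (point s) r m) * (mean n f / stat S pu e0 n s) * exp (- (t * c n))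
      \<le> (\<Sum>m. ?a f u m) * exp (- (t * c n))"
    by (intro mult_right_mono) auto
  then show ?thesis
    unfolding heat_eq[OF rs(1)] heat_eq[OF u] by (simp add: mult_ac)
qed

end

text \<open>The stationary measure is represented by its functional \<open>L\<close>, with
  positivity \<open>L_mono\<close> and total mass \<open>L_const\<close>. The extremal pairs are
  indexed from level 0 on.\<close>

locale up_down_limit = up_down_chains S e0 pu pd \<beta> c
  for S :: "nat \<Rightarrow> 's set" and e0 :: 's and pu pd :: "nat \<Rightarrow> 's \<Rightarrow> 's \<Rightarrow> real"
    and \<beta> c :: "nat \<Rightarrow> real" +
  fixes rr ss :: "nat \<Rightarrow> 's"
    and \<iota> :: "'s \<Rightarrow> 'e::metric_space"
    and d_o :: "'s \<Rightarrow> 'e \<Rightarrow>\<^sub>C real"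
    and T :: "real \<Rightarrow> ('e \<Rightarrow>\<^sub>C real) \<Rightarrow> ('e \<Rightarrow>\<^sub>C real)"
    and L :: "('e \<Rightarrow>\<^sub>C real) \<Rightarrow> real"
  assumes rr: "\<And>n. rr n \<in> S n" and ss: "\<And>n. ss n \<in> S n"
    and stat_ss: "\<And>n. 0 < stat S pu e0 n (ss n)"
    and far: "\<And>n m. 0 < mat_pow (S n) (trans_mat S pu pd n) m (rr n) (ss n) \<Longrightarrow> n \<le> m"
    and pd_rr: "\<And>n. pd (Suc n) (rr (Suc n)) (rr n) = 1"
    and compact_E: "compact (UNIV :: 'e set)"
    and L1: "\<And>x. \<exists>u. (\<forall>n. u n \<in> S n) \<and> (\<lambda>n. \<iota> (u n)) \<longlonglongrightarrow> x"
    and L2: "closure (span (d_o ` (\<Union>n. S n))) = UNIV"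
    and L3: "\<And>s. s \<in> (\<Union>n. S n) \<Longrightarrow>
           (\<lambda>n. SUP u\<in>S n. \<bar>dfun S pd s u - apply_bcontfun (d_o s) (\<iota> u)\<bar>) \<longlonglongrightarrow> 0"
    and feller: "feller_semigroup T"
    and T_h: "\<And>s t. s \<in> (\<Union>n. S n) \<Longrightarrow> 0 \<le> t \<Longrightarrow>
           T t (h_o S pu c d_o s) = exp (- t * c_prev c (level S s)) *\<^sub>R h_o S pu c d_o s"
    and L_linear: "bounded_linear L"
    and L_d: "\<And>s. s \<in> (\<Union>n. S n) \<Longrightarrow> L (d_o s) = stat S pu e0 (level S s) s"
    and L_mono: "\<And>f g. (\<And>x. apply_bcontfun f x \<le> apply_bcontfun g x) \<Longrightarrow> L f \<le> L g"
    and L_const: "L (const_bcontfun 1) = 1"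
begin

section \<open>Embedding the functions on one level into \<open>C(E)\<close>\<close>

definition emb :: "nat \<Rightarrow> ('s \<Rightarrow> real) \<Rightarrow> 'e \<Rightarrow>\<^sub>C real" where
  "emb n g = (\<Sum>s\<in>S n. g s *\<^sub>R d_o s)"

lemma emb_apply: "apply_bcontfun (emb n g) x = (\<Sum>s\<in>S n. g s * apply_bcontfun (d_o s) x)"
  by (simp add: emb_def apply_bcontfun_sum)

lemma emb_cong: "(\<And>s. s \<in> S n \<Longrightarrow> f s = g s) \<Longrightarrow> emb n f = emb n g"
  by (simp add: emb_def)

lemma emb_add: "emb n (\<lambda>u. f u + g u) = emb n f + emb n g"
  by (simp add: emb_def scaleR_add_left sum.distrib)

lemma emb_scale: "emb n (\<lambda>u. a * f u) = a *\<^sub>R emb n f"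
  by (simp add: emb_def scaleR_sum_right)

lemma emb_sum: "emb n (\<lambda>u. \<Sum>i\<in>I. a i * g i u) = (\<Sum>i\<in>I. a i *\<^sub>R emb n (g i))"
  unfolding emb_def scaleR_sum_left scaleR_sum_right by (subst sum.swap) simp

lemma L_emb: "L (emb n g) = mean n g"
proof -
  have lin: "linear L" using L_linear by (rule bounded_linear.linear)
  have "L (d_o s) = stat S pu e0 n s" if "s \<in> S n" for s
    using L_d[of s] that level_eq[OF that] by auto
  then show ?thesis
    by (simp add: emb_def linear_sum[OF lin] linear_cmul[OF lin] mean_def)
qed

lemma T_linear: "0 \<le> t \<Longrightarrow> linear (T t)"
  using feller by (simp add: feller_semigroup_def)

lemma T_nonneg: "0 \<le> t \<Longrightarrow> (\<And>x. 0 \<le> apply_bcontfun f x) \<Longrightarrow> 0 \<le> apply_bcontfun (T t f) x"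
  using feller unfolding feller_semigroup_def by blast

lemma T_bounded_linear: "0 \<le> t \<Longrightarrow> bounded_linear (T t)"
  using feller linear_add[OF T_linear[of t]] linear_cmul[OF T_linear[of t]]
  by (intro bounded_linear_intro[where K = 1]) (auto simp: feller_semigroup_def)

text \<open>On a level \<open>m \<ge> n\<close>, \<open>down m n g\<close> is the combination of the
  \<open>dfun S pd s\<close>, \<open>s \<in> S n\<close>, with coefficients \<open>g s\<close>, so
  (L3) is used for finitely many \<open>s\<close> only.\<close>

lemma down_emb_uniform:
  assumes "0 < e"
  shows "\<forall>\<^sub>F m in sequentially. \<forall>u\<in>S m. \<bar>down m n g u - apply_bcontfun (emb n g) (\<iota> u)\<bar> < e"
proof -
  let ?s = "\<lambda>m s. SUP u\<in>S m. \<bar>dfun S pd s u - apply_bcontfun (d_o s) (\<iota> u)\<bar>"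
  have "(\<lambda>m. \<Sum>s\<in>S n. \<bar>g s\<bar> * ?s m s) \<longlonglongrightarrow> (\<Sum>s\<in>S n. \<bar>g s\<bar> * 0)"
    by (intro tendsto_sum tendsto_mult tendsto_const L3) blast
  then have "\<forall>\<^sub>F m in sequentially. (\<Sum>s\<in>S n. \<bar>g s\<bar> * ?s m s) < e"
    using assms by (intro order_tendstoD(2)) auto
  then show ?thesis
    using eventually_ge_at_top[of n]
  proof eventually_elim
    case (elim m)
    show ?case
    proof
      fix u assume u: "u \<in> S m"
      have "dfun S pd s u = down_prod S pd m n u s" if "s \<in> S n" for s
        using that u elim level_eq[OF u] level_eq[OF that] by (auto simp: dfun_def)
      then have "\<bar>down m n g u - apply_bcontfun (emb n g) (\<iota> u)\<bar>
          = \<bar>\<Sum>s\<in>S n. g s * (dfun S pd s u - apply_bcontfun (d_o s) (\<iota> u))\<bar>"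
        by (simp add: down_def emb_apply sum_subtractf[symmetric] algebra_simps)
      also have "\<dots> \<le> (\<Sum>s\<in>S n. \<bar>g s * (dfun S pd s u - apply_bcontfun (d_o s) (\<iota> u))\<bar>)"
        by (rule sum_abs)
      also have "\<dots> \<le> (\<Sum>s\<in>S n. \<bar>g s\<bar> * ?s m s)"
        unfolding abs_mult using u finite_S
        by (intro sum_mono mult_left_mono cSUP_upper) auto
      finally show "\<bar>down m n g u - apply_bcontfun (emb n g) (\<iota> u)\<bar> < e"
        using elim by linarith
    qed
  qed
qed

text \<open>Uniform closeness on level \<open>m\<close> combines with continuity of
  \<open>emb n g\<close>. A subsequence is allowed because the points \<open>\<iota> (rr m)\<close>
  are only known to have a limit point.\<close>

lemma down_tendsto_emb:
  assumes v: "\<And>m. v m \<in> S m" and \<sigma>: "strict_mono \<sigma>" and lim: "(\<lambda>k. \<iota> (v (\<sigma> k))) \<longlonglongrightarrow> x"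
  shows "(\<lambda>k. down (\<sigma> k) n g (v (\<sigma> k))) \<longlonglongrightarrow> apply_bcontfun (emb n g) x"
proof -
  have "(\<lambda>m. down m n g (v m) - apply_bcontfun (emb n g) (\<iota> (v m))) \<longlonglongrightarrow> 0"
  proof (rule tendstoI)
    fix e :: real assume "0 < e"
    from down_emb_uniform[OF this, of n g]
    show "\<forall>\<^sub>F m in sequentially. dist (down m n g (v m) - apply_bcontfun (emb n g) (\<iota> (v m))) 0 < e"
      by eventually_elim (use v in \<open>simp add: dist_real_def\<close>)
  qed
  from LIMSEQ_subseq_LIMSEQ[OF this \<sigma>]
  have "(\<lambda>k. down (\<sigma> k) n g (v (\<sigma> k)) - apply_bcontfun (emb n g) (\<iota> (v (\<sigma> k)))) \<longlonglongrightarrow> 0"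
    by (simp add: o_def)
  moreover have "(\<lambda>k. apply_bcontfun (emb n g) (\<iota> (v (\<sigma> k)))) \<longlonglongrightarrow> apply_bcontfun (emb n g) x"
    using continuous_on_tendsto_compose[OF continuous_on_apply_bcontfun[of UNIV "emb n g"] lim] by simp
  ultimately show ?thesis using tendsto_add by fastforce
qed

text \<open>One sequence serves all \<open>n\<close> and \<open>g\<close>, so identities and
  inequalities between the functions \<open>down m n g\<close> pass to their embeddings.\<close>

lemma approximating_points:
  obtains v where "\<And>m. v m \<in> S m" "\<And>n g. (\<lambda>m. down m n g (v m)) \<longlonglongrightarrow> apply_bcontfun (emb n g) x"
proof -
  obtain v where v: "\<And>m. v m \<in> S m" "(\<lambda>m. \<iota> (v m)) \<longlonglongrightarrow> x" using L1[of x] by blast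
  have "(\<lambda>m. down m n g (v m)) \<longlonglongrightarrow> apply_bcontfun (emb n g) x" for n g
    using down_tendsto_emb[of v id x n g] v by (simp add: strict_mono_id[unfolded id_def] id_def)
  with v that show thesis by blast
qed

lemma emb_down:
  assumes "n \<le> m"
  shows "emb m (down m n g) = emb n g"
proof (rule bcontfun_eqI)
  fix x
  obtain v where v: "\<And>k. v k \<in> S k" "\<And>n g. (\<lambda>k. down k n g (v k)) \<longlonglongrightarrow> apply_bcontfun (emb n g) x"
    using approximating_points[of x] by metis
  have "\<forall>\<^sub>F k in sequentially. down k m (down m n g) (v k) = down k n g (v k)"
    using eventually_ge_at_top[of m] by eventually_elim (use assms v in \<open>simp add: down_down\<close>)
  with v(2)[of m "down m n g"]
  have "(\<lambda>k. down k n g (v k)) \<longlonglongrightarrow> apply_bcontfun (emb m (down m n g)) x"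
    using tendsto_cong by fast
  then show "apply_bcontfun (emb m (down m n g)) x = apply_bcontfun (emb n g) x"
    using LIMSEQ_unique v(2) by blast
qed

lemma emb_ge:
  assumes "\<And>s. s \<in> S n \<Longrightarrow> a \<le> g s"
  shows "a \<le> apply_bcontfun (emb n g) x"
proof -
  obtain v where v: "\<And>m. v m \<in> S m" "\<And>n g. (\<lambda>m. down m n g (v m)) \<longlonglongrightarrow> apply_bcontfun (emb n g) x"
    using approximating_points[of x] by metis
  have "a \<le> down m n g (v m)" if "n \<le> m" for m
  proof -
    have "0 \<le> down m n (\<lambda>s. g s - a) (v m)"
      using that assms v by (intro down_nonneg) auto
    also have "\<dots> = down m n g (v m) - down m n (\<lambda>_. a) (v m)"
      by (simp add: down_def sum_subtractf algebra_simps)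
    finally show ?thesis using that v by (simp add: down_const)
  qed
  then show ?thesis
    using v(2)[of n g] by (intro LIMSEQ_le_const) auto
qed

text \<open>Rows sum to 1, so all other entries in the row of \<open>rr (Suc m)\<close> vanish and
  the down-steps follow the path of the \<open>rr\<close> deterministically.\<close>

lemma down_rr: "n \<le> m \<Longrightarrow> down m n g (rr m) = g (rr n)"
proof (induction m)
  case (Suc m)
  have step: "dstep m f (rr (Suc m)) = f (rr m)" for f
  proof -
    have "(\<Sum>s\<in>S m - {rr m}. pd (Suc m) (rr (Suc m)) s) = 0"
      using stochastic_sum[OF stochastic_pd' rr, of m] pd_rr[of m] rr[of m] finite_S[of m]
      by (simp add: sum.remove[of "S m" "rr m"])
    then have "pd (Suc m) (rr (Suc m)) s = 0" if "s \<in> S m - {rr m}" for s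
      using that finite_S[of m] stochastic_nonneg[OF stochastic_pd' rr, of _ m]
      by (subst (asm) sum_nonneg_eq_0_iff) auto
    then have "dstep m f (rr (Suc m)) = pd (Suc m) (rr (Suc m)) (rr m) * f (rr m)"
      unfolding dstep_def using finite_S[of m] rr[of m]
      by (subst sum.remove[of _ "rr m"]) auto
    then show ?thesis by (simp add: pd_rr)
  qed
  show ?case
  proof (cases "n = Suc m")
    case True
    then show ?thesis by (simp add: down_same rr)
  next
    case False
    then show ?thesis using Suc by (simp add: down_Suc step)
  qed
qed (simp add: down_same rr)

text \<open>A limit point of the extremal starting points \<open>rr n\<close> is extremal for every \<open>n\<close> at once.\<close>

lemma extremal_point: "\<exists>x. \<forall>n g. apply_bcontfun (emb n g) x = g (rr n)"
proof -
  obtain x \<sigma> where \<sigma>: "strict_mono \<sigma>" and lim: "((\<lambda>m. \<iota> (rr m)) \<circ> \<sigma>) \<longlonglongrightarrow> x"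
    using compact_E unfolding compact_eq_seq_compact_metric seq_compact_def
    by (metis UNIV_I)
  have "apply_bcontfun (emb n g) x = g (rr n)" for n g
  proof (rule LIMSEQ_unique)
    show "(\<lambda>k. down (\<sigma> k) n g (rr (\<sigma> k))) \<longlonglongrightarrow> apply_bcontfun (emb n g) x"
      by (rule down_tendsto_emb[OF rr \<sigma>]) (use lim in \<open>simp add: o_def\<close>)
    have "\<forall>\<^sub>F k in sequentially. down (\<sigma> k) n g (rr (\<sigma> k)) = g (rr n)"
      using eventually_ge_at_top[of n]
      by eventually_elim (use \<sigma> seq_suble in \<open>blast intro: down_rr order.trans\<close>)
    then show "(\<lambda>k. down (\<sigma> k) n g (rr (\<sigma> k))) \<longlonglongrightarrow> g (rr n)"
      by (rule tendsto_eventually)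
  qed
  then show ?thesis by blast
qed

subsection \<open>The limiting semigroup on the embedded functions\<close>

lemma eta_same: "eta c n n = 1"
  by (simp add: eta_def)

text \<open>The factor \<open>m = j\<close> is split off; its denominator is nonzero by strict
  monotonicity.\<close>

lemma eta_step: "j < n \<Longrightarrow> eta c (Suc j) n * c j = (c_prev c j - c_prev c n) * eta c j n"
  using c_prev_strict_mono[of j n] by (simp add: eta_def prod.atLeast_Suc_lessThan)

text \<open>The counterpart of \<open>h_o\<close> on level \<open>n\<close>: for
  \<open>f = point s\<close> with \<open>s \<in> S n\<close> its embedding is
  \<open>h_o S pu c d_o s\<close>.\<close>

definition eigen :: "nat \<Rightarrow> ('s \<Rightarrow> real) \<Rightarrow> 's \<Rightarrow> real" where
  "eigen n f = (\<lambda>u. \<Sum>j\<le>n. eta c j n * du n j f u)"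

text \<open>Compare the coefficients of \<open>du n j f\<close>: for \<open>j < n\<close> they agree
  by \<open>eta_step\<close>, and for \<open>j = n\<close> only the diagonal term of the generator
  contributes.\<close>

lemma gen_eigen:
  assumes "u \<in> S n"
  shows "gen n (eigen n f) u = - c_prev c n * eigen n f u"
proof -
  have "gen n (eigen n f) u = (\<Sum>j<n. (c_prev c j - c_prev c n) * eta c j n * du n j f u)
      - (\<Sum>j<Suc n. eta c j n * c_prev c j * du n j f u)"
    unfolding eigen_def gen_du_sum[OF assms] lessThan_Suc_atMost
    by (simp add: eta_step)
  also have "\<dots> = (\<Sum>j<Suc n. - c_prev c n * (eta c j n * du n j f u))"
    by (simp add: sum_subtractf[symmetric] algebra_simps)
  finally show ?thesis
    by (simp only: eigen_def sum_distrib_left lessThan_Suc_atMost)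
qed

lemma emb_eigen: "emb n (eigen n f) = (\<Sum>j\<le>n. eta c j n *\<^sub>R emb j (up j n f))"
  unfolding eigen_def emb_sum by (intro sum.cong refl) (simp add: du_def emb_down)

lemma h_o_eq:
  assumes "s \<in> S n"
  shows "h_o S pu c d_o s = emb n (eigen n (point s))"
proof -
  have "h_o S pu c d_o s = (\<Sum>j\<le>n. \<Sum>r\<in>S j.
        (up_prod S pu (level S r) (level S s) r s * eta c (level S r) (level S s)) *\<^sub>R d_o r)"
    unfolding h_o_def level_eq[OF assms] using disjoint_S finite_S
    by (subst sum.UNION_disjoint) (auto simp: disjoint_family_on_def)
  also have "\<dots> = (\<Sum>j\<le>n. eta c j n *\<^sub>R emb j (up j n (point s)))"
    unfolding emb_def scaleR_sum_right using level_eq assms finite_S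
    by (intro sum.cong refl) (simp add: up_def sum_point)
  finally show ?thesis by (simp add: emb_eigen)
qed

lemma T_emb_eigen:
  assumes t: "0 \<le> t"
  shows "T t (emb n (eigen n f)) = exp (- t * c_prev c n) *\<^sub>R emb n (eigen n f)"
proof -
  have f: "f u = (\<Sum>s\<in>S n. f s * point s u)" if "u \<in> S n" for u
    using that finite_S[of n] by (simp add: point_def if_distrib[of "\<lambda>x. _ * x"] cong: if_cong)
  have "eigen n f = (\<lambda>u. \<Sum>s\<in>S n. f s * eigen n (point s) u)"
  proof
    fix u
    have "up j n (point s) v = up_prod S pu j n v s" if "s \<in> S n" for j s v
      using that finite_S by (simp add: up_def sum_point)
    then have up: "up j n f = (\<lambda>v. \<Sum>s\<in>S n. f s * up j n (point s) v)" for j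
      by (simp add: fun_eq_iff up_def[of j n f] mult.commute)
    show "eigen n f u = (\<Sum>s\<in>S n. f s * eigen n (point s) u)"
      unfolding eigen_def du_def up[of _] down_sum sum_distrib_left
      by (subst sum.swap) (simp add: mult_ac)
  qed
  then have "emb n (eigen n f) = (\<Sum>s\<in>S n. f s *\<^sub>R h_o S pu c d_o s)"
    by (simp add: emb_sum h_o_eq)
  moreover have "T t (h_o S pu c d_o s) = exp (- t * c_prev c n) *\<^sub>R h_o S pu c d_o s" if "s \<in> S n" for s
    using T_h[of s t] t that level_eq[OF that] by auto
  ultimately show ?thesis
    by (simp add: linear_sum[OF T_linear[OF t]] linear_cmul[OF T_linear[OF t]]
        scaleR_sum_right mult.commute)
qed

text \<open>Strong induction on \<open>n\<close>: \<open>f\<close> is an eigenfunction minus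
  functions coming from lower levels. Both semigroups multiply the eigenfunction by the same
  exponential; \<open>emb_down\<close> and \<open>heat_down\<close> move the rest to levels
  \<open>j < n\<close>.\<close>

lemma T_emb:
  assumes t: "0 \<le> t"
  shows "T t (emb n f) = emb n (heat n t f)"
proof (induction n arbitrary: f rule: less_induct)
  case (less n)
  let ?a = "\<lambda>j. eta c j n"
  \<comment> \<open>The summand \<open>j = n\<close> of \<open>eigen n f\<close> is \<open>f\<close>
    itself, as \<open>eta c n n = 1\<close>.\<close>
  have f: "f u = eigen n f u - (\<Sum>j<n. ?a j * du n j f u)" if "u \<in> S n" for u
    using that by (simp add: eigen_def lessThan_Suc_atMost[symmetric] eta_same du_same)
  have heat_f: "heat n t f u = exp (- t * c_prev c n) * eigen n f u
      - (\<Sum>j<n. ?a j * down n j (heat j t (up j n f)) u)" if u: "u \<in> S n" for u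
  proof -
    have "eigen n f u = (\<Sum>j<Suc n. ?a j * du n j f u)" for u
      by (simp add: eigen_def lessThan_Suc_atMost)
    \<comment> \<open>The summand \<open>j = n\<close> is \<open>heat n t f u\<close>, for which the
      identity is then solved.\<close>
    then have "heat n t (eigen n f) u = (\<Sum>j<Suc n. ?a j * heat n t (du n j f) u)"
      using heat_sum[OF u, where t = t and I = "{..<Suc n}" and a = ?a and g = "\<lambda>j. du n j f"] by (simp add: eigen_def[abs_def] lessThan_Suc_atMost)
    also have "\<dots> = (\<Sum>j<n. ?a j * down n j (heat j t (up j n f)) u) + heat n t f u"
      using u heat_cong[where f = "du n n f" and g = f and t = t, OF du_same u] by (simp add: eta_same du_def heat_down)
    finally show ?thesis
      using heat_eigen[OF gen_eigen u, of t f] by simp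
  qed
  have diff: "emb n (\<lambda>u. a * h u - (\<Sum>j<n. ?a j * g j u)) = a *\<^sub>R emb n h - (\<Sum>j<n. ?a j *\<^sub>R emb n (g j))"
    for a h g
    using emb_add[of n "\<lambda>u. a * h u - (\<Sum>j<n. ?a j * g j u)" "\<lambda>u. \<Sum>j<n. ?a j * g j u"]
    by (simp add: emb_sum emb_scale)
  have "emb n f = emb n (eigen n f) - (\<Sum>j<n. ?a j *\<^sub>R emb j (up j n f))"
    using diff[of 1 "eigen n f" "\<lambda>j. du n j f"] emb_cong[OF f]
    by (simp add: du_def emb_down)
  then have "T t (emb n f) = exp (- t * c_prev c n) *\<^sub>R emb n (eigen n f)
      - (\<Sum>j<n. ?a j *\<^sub>R emb j (heat j t (up j n f)))"
    by (simp add: linear_diff[OF T_linear[OF t]] linear_sum[OF T_linear[OF t]]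
        linear_cmul[OF T_linear[OF t]] T_emb_eigen[OF t] less)
  also have "\<dots> = emb n (heat n t f)"
    using diff[of "exp (- t * c_prev c n)" "eigen n f" "\<lambda>j. down n j (heat j t (up j n f))"]
      emb_cong[OF heat_f] by (simp add: emb_down)
  finally show ?case .
qed

subsection \<open>Separation distances\<close>

text \<open>The density at \<open>(rr n, ss n)\<close> of the transition matrix at time
  \<open>t\<close> with respect to the stationary distribution.\<close>

definition gap :: "nat \<Rightarrow> real \<Rightarrow> real" where
  "gap n t = heat n t (point (ss n)) (rr n) / stat S pu e0 n (ss n)"

lemma gap_bound:
  assumes f: "\<And>u. u \<in> S n \<Longrightarrow> 0 \<le> f u" and u: "u \<in> S n" and t: "0 \<le> t"
  shows "gap n t * mean n f \<le> heat n t f u"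
proof -
  \<comment> \<open>Matrix entries are nonnegative, and by \<open>far\<close> these are not
    positive.\<close>
  have "(tr n ^^ m) (point (ss n)) (rr n) = 0" if "m < n" for m
  proof -
    have "0 \<le> (tr n ^^ m) (point (ss n)) (rr n)"
      unfolding tr_pow_eq[OF rr] using rr pcoef_nonneg
      by (intro sum_nonneg mult_nonneg_nonneg du_nonneg) (auto simp: point_def)
    moreover have "\<not> 0 < (tr n ^^ m) (point (ss n)) (rr n)"
      using far[of n m] that by (auto simp: mat_pow_eq rr ss)
    ultimately show ?thesis by simp
  qed
  then show ?thesis
    unfolding gap_def by (intro heat_lower_bound rr ss f u stat_ss t)
qed

text \<open>Shared by the suprema over \<open>S n\<close> and over \<open>E\<close>: the bound is
  sharp as soon as the values at \<open>rr n\<close> occur.\<close>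

lemma Sup_separation:
  assumes upper: "\<And>x. x \<in> X \<Longrightarrow> x \<le> 1 - gap n t"
    and mem: "\<And>f. (\<And>u. u \<in> S n \<Longrightarrow> 0 < f u) \<Longrightarrow> 1 - heat n t f (rr n) / mean n f \<in> X"
  shows "Sup X = 1 - gap n t"
proof (rule cSup_eq_limit[OF upper])
  \<comment> \<open>The indicator \<open>point (ss n)\<close> is made positive by adding a constant
    that tends to 0.\<close>
  let ?f = "\<lambda>k u. point (ss n) u + inverse (real (Suc k))"
  show "1 - heat n t (?f k) (rr n) / mean n (?f k) \<in> X" for k
    by (rule mem) (auto simp: point_def intro!: add_nonneg_pos)
  have const: "heat n t (\<lambda>_. a) (rr n) = a" for a
  proof -
    have "gen n (\<lambda>_. a) u = - 0 * a" if "u \<in> S n" for u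
      using that by (simp add: gen_def tr_eq dstep_const ustep_const cong: ustep_cong)
    from heat_eigen[OF this rr, of t] show ?thesis by simp
  qed
  \<comment> \<open>The two summands are indexed by \<open>bool\<close> to fit the finite-sum form
    of \<open>heat_sum\<close>.\<close>
  have "heat n t (?f k) (rr n) = heat n t (point (ss n)) (rr n) + inverse (real (Suc k))" for k
    using heat_sum[OF rr, where n = n and t = t and I = UNIV and a = "\<lambda>_::bool. 1"
        and g = "\<lambda>b. if b then point (ss n) else (\<lambda>_. inverse (real (Suc k)))"]
    by (simp add: UNIV_bool const add.commute)
  moreover have "mean n (?f k) = stat S pu e0 n (ss n) + inverse (real (Suc k))" for k
    using mean_const[of n "inverse (real (Suc k))"] mean_point[OF ss, of n]
    by (simp add: mean_def sum.distrib distrib_right)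
  moreover have "(\<lambda>k. 1 - (heat n t (point (ss n)) (rr n) + inverse (real (Suc k)))
      / (stat S pu e0 n (ss n) + inverse (real (Suc k)))) \<longlonglongrightarrow>
      1 - (heat n t (point (ss n)) (rr n) + 0) / (stat S pu e0 n (ss n) + 0)"
    using stat_ss[of n] by (intro tendsto_intros LIMSEQ_inverse_real_of_nat) auto
  ultimately show "(\<lambda>k. 1 - heat n t (?f k) (rr n) / mean n (?f k)) \<longlonglongrightarrow> 1 - gap n t"
    by (simp add: gap_def)
qed

lemma sep_chain_eq:
  assumes t: "0 \<le> t"
  shows "sep_chain S pu pd e0 c n t = 1 - gap n t"
  unfolding sep_chain_def mean_def[symmetric]
proof (rule Sup_separation)
  fix x assume "x \<in> (\<lambda>(r, f). 1 - heat n t f r / mean n f) ` (S n \<times> {f. \<forall>u\<in>S n. 0 < f u})"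
  then obtain r f where "r \<in> S n" "\<forall>u\<in>S n. 0 < f u" and x: "x = 1 - heat n t f r / mean n f" by auto
  then have "gap n t * mean n f \<le> heat n t f r" "0 < mean n f"
    using t less_imp_le[of 0 "f _"] by (auto intro!: gap_bound mean_pos)
  then show "x \<le> 1 - gap n t"
    unfolding x by (simp add: pos_le_divide_eq)
next
  fix f :: "'s \<Rightarrow> real" assume "\<And>u. u \<in> S n \<Longrightarrow> 0 < f u"
  then show "1 - heat n t f (rr n) / mean n f
      \<in> (\<lambda>(r, f). 1 - heat n t f r / mean n f) ` (S n \<times> {f. \<forall>u\<in>S n. 0 < f u})"
    using rr[of n] by (intro image_eqI[of _ _ "(rr n, f)"]) auto
qed

section \<open>Suprema over embedded positive functions\<close>

abbreviation sep_at :: "real \<Rightarrow> 'e \<Rightarrow> ('e \<Rightarrow>\<^sub>C real) \<Rightarrow> real" where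
  "sep_at t x f \<equiv> 1 - apply_bcontfun (T t f) x / L f"

text \<open>The functions \<open>f^o\<close> with \<open>f\<close> in \<open>Hpos S pd n\<close>, as
  \<open>lift_o_Hpos\<close> confirms.\<close>

definition emb_pos :: "nat \<Rightarrow> ('e \<Rightarrow>\<^sub>C real) set" where
  "emb_pos n = {emb n g | g. \<forall>u\<in>S n. 0 < g u}"

text \<open>A down-step image is positive again and has the same embedding.\<close>

lemma emb_pos_mono: "n \<le> m \<Longrightarrow> emb_pos n \<subseteq> emb_pos m"
proof (rule lift_Suc_mono_le[of emb_pos])
  fix n
  show "emb_pos n \<subseteq> emb_pos (Suc n)"
  proof
    fix h assume "h \<in> emb_pos n"
    then obtain g where "h = emb n g" "\<forall>u\<in>S n. 0 < g u" by (auto simp: emb_pos_def)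
    then have "h = emb (Suc n) (down (Suc n) n g)" "\<forall>u\<in>S (Suc n). 0 < down (Suc n) n g u"
      by (simp_all add: emb_down down_Suc) (simp add: down_same dstep_pos cong: dstep_cong)
    then show "h \<in> emb_pos (Suc n)" unfolding emb_pos_def by blast
  qed
qed

lemma L_emb_pos: "h \<in> emb_pos n \<Longrightarrow> 0 < L h"
  by (auto simp: emb_pos_def L_emb intro!: mean_pos)

lemma T_emb_pos_ge:
  assumes "h \<in> emb_pos n" "0 \<le> t"
  shows "gap n t * L h \<le> apply_bcontfun (T t h) x"
proof -
  obtain g where h: "h = emb n g" and g: "\<forall>u\<in>S n. 0 < g u" using assms by (auto simp: emb_pos_def)
  show ?thesis
    unfolding h L_emb T_emb[OF assms(2)] using g assms(2)
    by (intro emb_ge gap_bound) (auto intro: less_imp_le)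
qed

text \<open>Positivity of \<open>emb\<close> carries the bound of the chain to all of
  \<open>E\<close>; at the extremal point, evaluation is evaluation at \<open>rr n\<close>, which
  gives sharpness.\<close>

lemma Sup_emb_pos:
  assumes t: "0 \<le> t"
  shows "(SUP (x, h) \<in> UNIV \<times> emb_pos n. sep_at t x h) = 1 - gap n t"
proof (rule Sup_separation)
  fix y assume "y \<in> (\<lambda>(x, h). sep_at t x h) ` (UNIV \<times> emb_pos n)"
  then obtain x h where h: "h \<in> emb_pos n" and y: "y = sep_at t x h" by auto
  show "y \<le> 1 - gap n t"
    using T_emb_pos_ge[OF h t, of x] L_emb_pos[OF h] by (simp add: y field_simps)
next
  fix f :: "'s \<Rightarrow> real" assume f: "\<And>u. u \<in> S n \<Longrightarrow> 0 < f u"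
  obtain x where x: "\<And>n g. apply_bcontfun (emb n g) x = g (rr n)" using extremal_point by blast
  have "emb n f \<in> emb_pos n" using f by (auto simp: emb_pos_def)
  moreover have "1 - heat n t f (rr n) / mean n f = sep_at t x (emb n f)"
    by (simp add: T_emb[OF t] L_emb x)
  ultimately show "1 - heat n t f (rr n) / mean n f \<in> (\<lambda>(x, h). sep_at t x h) ` (UNIV \<times> emb_pos n)"
    by force
qed

text \<open>The minimum is attained by compactness; applied to \<open>L f\<close>, the same bound
  keeps the denominator in \<open>sep_at\<close> positive.\<close>

lemma positive_lower_bound:
  assumes "\<And>y. 0 < apply_bcontfun f y"
  obtains \<delta> where "0 < \<delta>" "\<And>y. \<delta> \<le> apply_bcontfun f y" "\<delta> \<le> L f"
proof -
  have "\<exists>x\<in>UNIV. \<forall>y\<in>UNIV. apply_bcontfun f x \<le> apply_bcontfun f y"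
    using compact_E by (intro continuous_attains_inf) auto
  then obtain x where x: "\<And>y. apply_bcontfun f x \<le> apply_bcontfun f y" by auto
  let ?d = "apply_bcontfun f x"
  have "L (?d *\<^sub>R const_bcontfun 1) \<le> L f" using x by (intro L_mono) (simp add: const_bcontfun.rep_eq)
  then have "?d \<le> L f"
    by (simp add: linear_cmul[OF bounded_linear.linear[OF L_linear]] L_const)
  with that x assms show thesis by blast
qed

lemma sep_at_le_1:
  assumes "0 \<le> t" "\<And>y. 0 < apply_bcontfun f y"
  shows "sep_at t x f \<le> 1"
proof -
  obtain \<delta> where "0 < \<delta>" "\<delta> \<le> L f" using positive_lower_bound[OF assms(2)] by metis
  then show ?thesis using T_nonneg[OF assms(1), of f x] assms(2) by (simp add: less_imp_le)
qed

lemma emb_pos_positive: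
  assumes "h \<in> emb_pos n"
  shows "0 < apply_bcontfun h x"
proof -
  obtain g where h: "h = emb n g" and g: "\<forall>u\<in>S n. 0 < g u" using assms by (auto simp: emb_pos_def)
  have "0 < Min (g ` S n)" using g finite_S S_nonempty by simp
  also have "\<dots> \<le> apply_bcontfun h x"
    unfolding h using finite_S by (intro emb_ge) simp
  finally show ?thesis .
qed

lemma span_emb:
  assumes "h \<in> span (d_o ` (\<Union>n. S n))"
  shows "\<exists>n g. h = emb n g"
proof -
  have "subspace {emb n g | n g. True}"
    unfolding subspace_def
  proof (intro conjI ballI allI)
    have "0 = emb 0 (\<lambda>_. 0)" by (simp add: emb_def)
    then show "0 \<in> {emb n g | n g. True}" by blast
  next
    fix a b assume "a \<in> {emb n g | n g. True}" "b \<in> {emb n g | n g. True}"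
    then obtain n g m k where "a = emb n g" "b = emb m k" by blast
    \<comment> \<open>Both summands are moved to a common level.\<close>
    then have "a + b = emb (max n m) (\<lambda>u. down (max n m) n g u + down (max n m) m k u)"
      by (simp add: emb_add emb_down)
    then show "a + b \<in> {emb n g | n g. True}" by blast
  next
    fix a :: real and b assume "b \<in> {emb n g | n g. True}"
    then obtain n g where "b = emb n g" by blast
    then have "a *\<^sub>R b = emb n (\<lambda>u. a * g u)" by (simp add: emb_scale)
    then show "a *\<^sub>R b \<in> {emb n g | n g. True}" by blast
  qed
  moreover have "d_o ` (\<Union>n. S n) \<subseteq> {emb n g | n g. True}"
  proof clarify
    fix n s assume "s \<in> S n"
    then have "d_o s = emb n (point s)"
      using finite_S[of n] by (simp add: emb_def point_def if_distrib[of "\<lambda>x. x *\<^sub>R _"] cong: if_cong)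
    then show "\<exists>n g. d_o s = emb n g \<and> True" by blast
  qed
  ultimately have "span (d_o ` (\<Union>n. S n)) \<subseteq> {emb n g | n g. True}" by (rule span_minimal[rotated])
  with assms show ?thesis by blast
qed

text \<open>Below a positive continuous function lies a positive bound, and \<open>down m n g\<close> is uniformly
  close to \<open>emb n g\<close> for large \<open>m\<close>; hence approximants may be taken positive at a high level.\<close>

lemma positive_approximation:
  assumes "\<And>y. 0 < apply_bcontfun f y"
  shows "f \<in> closure (\<Union>n. emb_pos n)"
  unfolding closure_approachable
proof (intro allI impI)
  fix e :: real assume e: "0 < e"
  obtain \<delta> where \<delta>: "0 < \<delta>" "\<And>y. \<delta> \<le> apply_bcontfun f y" using positive_lower_bound[OF assms] by metis
  have "f \<in> closure (span (d_o ` (\<Union>n. S n)))" using L2 by simp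
  \<comment> \<open>Accuracy \<open>\<delta> / 2\<close> leaves \<open>h \<ge> \<delta> / 2\<close>,
    which is then spent on the passage to level \<open>m\<close>.\<close>
  then obtain h where h: "h \<in> span (d_o ` (\<Union>n. S n))" and hf: "dist h f < min e (\<delta> / 2)"
    using e \<delta> unfolding closure_approachable by (metis half_gt_zero min_less_iff_conj)
  obtain n g where hg: "h = emb n g" using span_emb[OF h] by blast
  have h_ge: "\<delta> / 2 \<le> apply_bcontfun h y" for y
  proof -
    have "dist (apply_bcontfun h y) (apply_bcontfun f y) < \<delta> / 2"
      using dist_bounded[of h y f] hf by linarith
    then show ?thesis using \<delta>(2)[of y] unfolding dist_real_def by linarith
  qed
  have "\<forall>\<^sub>F m in sequentially. n \<le> m \<and> (\<forall>u\<in>S m. \<bar>down m n g u - apply_bcontfun (emb n g) (\<iota> u)\<bar> < \<delta> / 2)"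
    using \<delta> by (intro eventually_conj eventually_ge_at_top down_emb_uniform) auto
  then obtain m where m: "n \<le> m" "\<forall>u\<in>S m. \<bar>down m n g u - apply_bcontfun (emb n g) (\<iota> u)\<bar> < \<delta> / 2"
    unfolding eventually_sequentially by blast
  have "\<forall>u\<in>S m. 0 < down m n g u"
  proof
    fix u assume "u \<in> S m"
    then show "0 < down m n g u"
      using m(2)[rule_format, of u] h_ge[of "\<iota> u"] unfolding hg by linarith
  qed
  then have "h \<in> emb_pos m"
    unfolding emb_pos_def hg emb_down[OF m(1), symmetric] by blast
  then show "\<exists>y\<in>\<Union>n. emb_pos n. dist y f < e" using hf by auto
qed

text \<open>Monotonicity is read off from suprema over the increasing sets
  \<open>emb_pos n\<close>.\<close>

lemma gap_decseq: "0 \<le> t \<Longrightarrow> n \<le> m \<Longrightarrow> gap m t \<le> gap n t"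
proof -
  assume t: "0 \<le> t" and nm: "n \<le> m"
  have "(SUP (x, h) \<in> UNIV \<times> emb_pos n. sep_at t x h) \<le> (SUP (x, h) \<in> UNIV \<times> emb_pos m. sep_at t x h)"
  proof (rule cSUP_subset_mono)
    have "emb n (\<lambda>_. 1) \<in> emb_pos n" by (auto simp: emb_pos_def)
    then show "UNIV \<times> emb_pos n \<noteq> {}" by blast
    show "bdd_above ((\<lambda>(x, h). sep_at t x h) ` (UNIV \<times> emb_pos m))"
      using sep_at_le_1[OF t emb_pos_positive] by (intro bdd_aboveI[of _ 1]) auto
  qed (use emb_pos_mono[OF nm] in auto)
  then show ?thesis by (simp add: Sup_emb_pos[OF t])
qed

text \<open>The increasing sequence has a limit \<open>l\<close> below the supremum. Conversely, the
  bound by \<open>l\<close> holds on every \<open>emb_pos n\<close> and extends to all positive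
  functions by density.\<close>

lemma gap_tendsto:
  assumes t: "0 \<le> t"
  shows "(\<lambda>n. 1 - gap n t) \<longlonglongrightarrow> (SUP (x, f) \<in> UNIV \<times> {f. \<forall>y. 0 < apply_bcontfun f y}. sep_at t x f)"
    (is "_ \<longlonglongrightarrow> Sup (?F ` ?P)")
proof -
  have bdd: "bdd_above (?F ` ?P)"
    using sep_at_le_1[OF t] by (intro bdd_aboveI[of _ 1]) auto
  have pos: "UNIV \<times> emb_pos n \<subseteq> ?P" for n using emb_pos_positive by auto
  have ne: "(UNIV :: 'e set) \<times> emb_pos n \<noteq> {}" for n
  proof -
    have "emb n (\<lambda>_. 1) \<in> emb_pos n" by (auto simp: emb_pos_def)
    then show ?thesis by blast
  qed
  have le: "1 - gap n t \<le> Sup (?F ` ?P)" for n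
    unfolding Sup_emb_pos[OF t, symmetric] by (rule cSUP_subset_mono[OF ne bdd pos]) simp
  have "incseq (\<lambda>n. 1 - gap n t)"
    by (intro monoI) (simp add: gap_decseq[OF t])
  then obtain l where l: "(\<lambda>n. 1 - gap n t) \<longlonglongrightarrow> l" and up: "\<And>n. 1 - gap n t \<le> l"
    using incseq_convergent[of "\<lambda>n. 1 - gap n t" "Sup (?F ` ?P)"] le by blast
  have "Sup (?F ` ?P) \<le> l"
  proof (rule cSup_least)
    show "?F ` ?P \<noteq> {}" using ne[of 0] pos[of 0] by blast
    fix y assume "y \<in> ?F ` ?P"
    then obtain x f where f: "\<And>z. 0 < apply_bcontfun f z" and y: "y = sep_at t x f" by auto
    \<comment> \<open>The inequality \<open>sep_at t x h \<le> l\<close>, cleared of its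
      denominator, is a closed condition on \<open>h\<close>.\<close>
    let ?A = "{h. (1 - l) * L h \<le> apply_bcontfun (T t h) x}"
    have "closed ?A"
      by (intro closed_Collect_le continuous_intros
          bounded_linear.continuous_on[OF L_linear] bounded_linear.continuous_on[OF T_bounded_linear[OF t]]
          bounded_linear.continuous_on[OF apply_bcontfun_bounded_linear])
    moreover have "(\<Union>n. emb_pos n) \<subseteq> ?A"
    proof clarify
      fix h n assume h: "h \<in> emb_pos n"
      have "(1 - l) * L h \<le> gap n t * L h"
        using up[of n] L_emb_pos[OF h] by (intro mult_right_mono) auto
      also have "\<dots> \<le> apply_bcontfun (T t h) x" by (rule T_emb_pos_ge[OF h t])
      finally show "(1 - l) * L h \<le> apply_bcontfun (T t h) x" .
    qed
    ultimately have "f \<in> ?A" using closure_minimal positive_approximation[OF f] by blast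
    moreover obtain \<delta> where "0 < \<delta>" "\<delta> \<le> L f" using positive_lower_bound[OF f] by metis
    ultimately show "y \<le> l" by (simp add: y field_simps)
  qed
  moreover have "l \<le> Sup (?F ` ?P)" by (rule LIMSEQ_le_const2[OF l]) (use le in auto)
  ultimately show ?thesis using l by simp
qed

subsection \<open>The lifting map on \<open>H\<close>\<close>

lemma sum_by_level:
  fixes F :: "'s \<Rightarrow> 'b::real_vector"
  assumes "finite A" "A \<subseteq> (\<Union>n. S n)" "\<And>s. s \<in> A \<Longrightarrow> level S s \<le> n"
    "\<And>s. s \<notin> A \<Longrightarrow> F s = 0"
  shows "sum F A = (\<Sum>k\<le>n. sum F (S k))"
proof -
  have "sum F A = sum F (\<Union>k\<in>{..n}. S k)"
  proof (rule sum.mono_neutral_left)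
    show "A \<subseteq> (\<Union>k\<in>{..n}. S k)"
      using assms(2,3) level_eq by fastforce
  qed (use assms finite_S in auto)
  also have "\<dots> = (\<Sum>k\<le>n. sum F (S k))"
    using disjoint_S finite_S by (intro sum.UNION_disjoint) (auto simp: disjoint_family_on_def)
  finally show ?thesis .
qed

lemma dcomb_eq:
  assumes a: "a \<in> coeffs S" and u: "u \<in> S m"
  shows "dcomb S pd a u = (\<Sum>k\<le>m. down m k a u)"
proof -
  have d: "dfun S pd s u = down_prod S pd m k u s" if "s \<in> S k" "k \<le> m" for s k
    using that u level_eq[OF u] level_eq[OF that(1)] by (auto simp: dfun_def)
  have z: "dfun S pd s u = 0" if "\<not> level S s \<le> m" for s
    using that level_eq[OF u] by (simp add: dfun_def)
  have "dcomb S pd a u = (\<Sum>s | a s \<noteq> 0 \<and> level S s \<le> m. a s * dfun S pd s u)"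
    unfolding dcomb_def using a z by (intro sum.mono_neutral_right) (auto simp: coeffs_def)
  also have "\<dots> = (\<Sum>k\<le>m. \<Sum>s\<in>S k. a s * dfun S pd s u)"
    using a z by (intro sum_by_level) (auto simp: coeffs_def)
  also have "\<dots> = (\<Sum>k\<le>m. down m k a u)"
    unfolding down_def by (intro sum.cong refl) (simp add: d mult.commute)
  finally show ?thesis .
qed

text \<open>Triangularity: on level \<open>m\<close> the combination is its own coefficient plus
  terms from lower levels, so induction recovers the coefficients.\<close>

lemma dcomb_inj:
  assumes a: "a \<in> coeffs S" and b: "b \<in> coeffs S" and eq: "dcomb S pd a = dcomb S pd b"
  shows "a = b"
proof -
  have main: "\<forall>u\<in>S m. a u = b u" for m
  proof (induction m rule: less_induct)
    case (less m)
    show ?case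
    proof
      fix u assume u: "u \<in> S m"
      have split: "dcomb S pd g u = (\<Sum>k<m. down m k g u) + g u" if "g \<in> coeffs S" for g
        using dcomb_eq[OF that u] u by (simp add: lessThan_Suc_atMost[symmetric] down_same)
      have "(\<Sum>k<m. down m k a u) = (\<Sum>k<m. down m k b u)"
        using less by (intro sum.cong refl down_cong) auto
      then show "a u = b u" using split[OF a] split[OF b] eq by simp
    qed
  qed
  have "a u = b u" if "u \<notin> (\<Union>n. S n)" for u
    using that a b by (auto simp: coeffs_def) (metis (mono_tags, lifting) UN_E mem_Collect_eq subsetD)+
  with main show ?thesis by blast
qed

text \<open>For \<open>f\<close> in \<open>H_n\<close>, \<open>f^o\<close> depends only on the
  values of \<open>f\<close> on \<open>S n\<close>: each \<open>emb k a\<close> is lifted to level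
  \<open>n\<close>, and there the images sum to \<open>f\<close>.\<close>

lemma lift_o_dcomb:
  assumes a: "a \<in> coeffs S" and n: "\<And>s. a s \<noteq> 0 \<Longrightarrow> level S s \<le> n"
  shows "lift_o S pd d_o (dcomb S pd a) = emb n (dcomb S pd a)"
proof -
  have "(THE b. b \<in> coeffs S \<and> dcomb S pd a = dcomb S pd b) = a"
    using a dcomb_inj by (intro the_equality) auto
  then have "lift_o S pd d_o (dcomb S pd a) = (\<Sum>s | a s \<noteq> 0. a s *\<^sub>R d_o s)"
    by (simp add: lift_o_def)
  also have "\<dots> = (\<Sum>k\<le>n. emb k a)"
    unfolding emb_def using a n by (intro sum_by_level) (auto simp: coeffs_def)
  also have "\<dots> = (\<Sum>k\<le>n. 1 *\<^sub>R emb n (down n k a))"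
    by (intro sum.cong refl) (simp add: emb_down)
  also have "\<dots> = emb n (dcomb S pd a)"
    unfolding emb_sum[symmetric] by (rule emb_cong) (simp add: dcomb_eq[OF a])
  finally show ?thesis .
qed

lemma lift_o_Hpos: "lift_o S pd d_o ` Hpos S pd n = emb_pos n"
proof
  show "lift_o S pd d_o ` Hpos S pd n \<subseteq> emb_pos n"
    using lift_o_dcomb by (auto simp: Hpos_def Hspace_def emb_pos_def)
  show "emb_pos n \<subseteq> lift_o S pd d_o ` Hpos S pd n"
  proof
    fix h assume "h \<in> emb_pos n"
    then obtain g where h: "h = emb n g" and g: "\<forall>u\<in>S n. 0 < g u" by (auto simp: emb_pos_def)
    \<comment> \<open>Only the \<open>dfun S pd s\<close> with \<open>s \<in> S n\<close> are used;
      on level \<open>n\<close> they are indicators, so the combination restricts to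
      \<open>g\<close>.\<close>
    define a where "a s = (if s \<in> S n then g s else 0)" for s
    have supp: "{s. a s \<noteq> 0} \<subseteq> S n" by (auto simp: a_def)
    then have a: "a \<in> coeffs S" using finite_S by (auto simp: coeffs_def intro: finite_subset)
    have lev: "level S s \<le> n" if "a s \<noteq> 0" for s using that supp level_eq by fastforce
    have eq: "dcomb S pd a u = g u" if u: "u \<in> S n" for u
    proof -
      have "a s = 0" if "k < n" "s \<in> S k" for k s
        using that level_eq[of s k] level_eq[of s n] by (auto simp: a_def)
      then have "down n k a u = 0" if "k < n" for k
        using that by (simp add: down_def)
      then show ?thesis
        using u by (simp add: dcomb_eq[OF a u] lessThan_Suc_atMost[symmetric] down_same a_def)
    qed
    have "dcomb S pd a \<in> Hpos S pd n"
      using a lev eq g by (auto simp: Hpos_def Hspace_def)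
    moreover have "h = lift_o S pd d_o (dcomb S pd a)"
      using lift_o_dcomb[OF a lev] emb_cong[OF eq] h by simp
    ultimately show "h \<in> lift_o S pd d_o ` Hpos S pd n" by blast
  qed
qed

lemma separation:
  assumes t: "0 \<le> t"
  shows "sep_chain S pu pd e0 c n t = (SUP (x, f) \<in> UNIV \<times> Hpos S pd n. sep_at t x (lift_o S pd d_o f))"
    and "mono (\<lambda>n. sep_chain S pu pd e0 c n t)"
    and "(\<lambda>n. sep_chain S pu pd e0 c n t) \<longlonglongrightarrow>
      (SUP (x, f) \<in> UNIV \<times> {f. \<forall>y. 0 < apply_bcontfun f y}. sep_at t x f)"
proof -
  have "(\<lambda>(x, f). sep_at t x (lift_o S pd d_o f)) ` (UNIV \<times> Hpos S pd n)
      = (\<lambda>(x, h). sep_at t x h) ` (UNIV \<times> lift_o S pd d_o ` Hpos S pd n)"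
    by force
  then show "sep_chain S pu pd e0 c n t = (SUP (x, f) \<in> UNIV \<times> Hpos S pd n. sep_at t x (lift_o S pd d_o f))"
    by (simp add: sep_chain_eq[OF t] lift_o_Hpos Sup_emb_pos[OF t])
  show "mono (\<lambda>n. sep_chain S pu pd e0 c n t)"
    by (intro monoI) (simp add: sep_chain_eq[OF t] gap_decseq[OF t])
  show "(\<lambda>n. sep_chain S pu pd e0 c n t) \<longlonglongrightarrow>
      (SUP (x, f) \<in> UNIV \<times> {f. \<forall>y. 0 < apply_bcontfun f y}. sep_at t x f)"
    using gap_tendsto[OF t] by (simp add: sep_chain_eq[OF t])
qed

end

section \<open>Assembly: level 0 and the stationary measure\<close>

theorem theorem4p15:
  fixes S :: "nat \<Rightarrow> 's set" and e0 :: 's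
    and pu pd :: "nat \<Rightarrow> 's \<Rightarrow> 's \<Rightarrow> real"
    and \<beta> c :: "nat \<Rightarrow> real"
    and rr ss :: "nat \<Rightarrow> 's"
    and \<iota> :: "'s \<Rightarrow> 'e::metric_space"
    and d_o :: "'s \<Rightarrow> 'e \<Rightarrow>\<^sub>C real"
    and T :: "real \<Rightarrow> ('e \<Rightarrow>\<^sub>C real) \<Rightarrow> ('e \<Rightarrow>\<^sub>C real)"
    and L :: "('e \<Rightarrow>\<^sub>C real) \<Rightarrow> real"
    and M :: "'e measure"
  assumes "\<And>n. finite (S n)" and "disjoint_family S" and "S 0 = {e0}"
    and "\<And>n. stochastic (S n) (S (Suc n)) (pu n)"
    and "\<And>n. n \<ge> 1 \<Longrightarrow> stochastic (S n) (S (n - 1)) (pd n)"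
    and "\<And>n r s. n \<ge> 1 \<Longrightarrow> r \<in> S n \<Longrightarrow> s \<in> S n \<Longrightarrow>
           mat_mul (S (Suc n)) (pu n) (pd (Suc n)) r s
             = \<beta> n * mat_mul (S (n - 1)) (pd n) (pu (n - 1)) r s + (1 - \<beta> n) * mat_one r s"
    and "\<And>n. n \<ge> 1 \<Longrightarrow> 0 < \<beta> n \<and> \<beta> n < 1"
    and "\<And>n. 0 < c n"
    and "\<And>n. n \<ge> 1 \<Longrightarrow> c (n - 1) / c n = \<beta> n"
    and "filterlim c at_top sequentially"
    and "\<And>n. n \<ge> 1 \<Longrightarrow> rr n \<in> S n \<and> ss n \<in> S n"
    and "\<And>n. n \<ge> 1 \<Longrightarrow> 0 < stat S pu e0 n (ss n)"
    and "\<And>n. n \<ge> 1 \<Longrightarrow> 0 < mat_pow (S n) (trans_mat S pu pd n) n (rr n) (ss n)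
           \<and> (\<forall>m. 0 < mat_pow (S n) (trans_mat S pu pd n) m (rr n) (ss n) \<longrightarrow> n \<le> m)"
    and "\<And>n. n \<ge> 1 \<Longrightarrow> pd (Suc n) (rr (Suc n)) (rr n) = 1"
    and "compact (UNIV :: 'e set)"
    and L1: "\<And>x. \<exists>u. (\<forall>n. u n \<in> S n) \<and> (\<lambda>n. \<iota> (u n)) \<longlonglongrightarrow> x"
    and L2: "closure (span (d_o ` (\<Union>n. S n))) = UNIV"
    and L3: "\<And>s. s \<in> (\<Union>n. S n) \<Longrightarrow>
           (\<lambda>n. SUP u\<in>S n. \<bar>dfun S pd s u - apply_bcontfun (d_o s) (\<iota> u)\<bar>) \<longlonglongrightarrow> 0"
    and "feller_semigroup T"
    and "\<And>s t. s \<in> (\<Union>n. S n) \<Longrightarrow> 0 \<le> t \<Longrightarrow>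
           T t (h_o S pu c d_o s) = exp (- t * c_prev c (level S s)) *\<^sub>R h_o S pu c d_o s"
    and "bounded_linear L"
    and "\<And>s. s \<in> (\<Union>n. S n) \<Longrightarrow> L (d_o s) = stat S pu e0 (level S s) s"
    and "prob_space M" and "sets M = sets borel"
    and "\<And>f. (\<integral>x. apply_bcontfun f x \<partial>M) = L f"
  shows "(\<forall>n. \<forall>t\<ge>0. sep_chain S pu pd e0 c n t
            = (SUP (x, f) \<in> UNIV \<times> Hpos S pd n.
                 1 - apply_bcontfun (T t (lift_o S pd d_o f)) x / L (lift_o S pd d_o f)))
       \<and> (\<forall>t\<ge>0. mono (\<lambda>n. sep_chain S pu pd e0 c n t)
            \<and> (\<lambda>n. sep_chain S pu pd e0 c n t) \<longlonglongrightarrow> sep_limit T M t)"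
proof -
  interpret chains: up_down_chains S e0 pu pd \<beta> c
    by unfold_locales (fact assms)+
  \<comment> \<open>The extremal pairs are given from level 1 on; at level 0 the only state
    \<open>e0\<close> serves as both.\<close>
  define rr' where "rr' n = (if n = 0 then e0 else rr n)" for n
  define ss' where "ss' n = (if n = 0 then e0 else ss n)" for n
  have M_UNIV: "measure M UNIV = 1"
    using prob_space.prob_space[OF assms(23)] sets_eq_imp_space_eq[OF assms(24)] by simp
  have L_mono: "L f \<le> L g" if "\<And>x. apply_bcontfun f x \<le> apply_bcontfun g x" for f g
  proof -
    have "0 \<le> (\<integral>x. apply_bcontfun (g - f) x \<partial>M)"
      by (rule Bochner_Integration.integral_nonneg) (simp add: that)
    then show ?thesis
      unfolding assms(25) by (simp add: linear_diff[OF bounded_linear.linear[OF assms(21)]])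
  qed
  have L_const: "L (const_bcontfun 1) = 1"
    using assms(25)[of "const_bcontfun 1"] sets_eq_imp_space_eq[OF assms(24)] M_UNIV
    by (simp add: const_bcontfun.rep_eq)
  interpret lim: up_down_limit S e0 pu pd \<beta> c rr' ss' \<iota> d_o T L
  proof (intro up_down_limit.intro up_down_limit_axioms.intro)
    fix n m
    show "rr' n \<in> S n" "ss' n \<in> S n" "0 < stat S pu e0 n (ss' n)"
      using assms(3) assms(11,12)[of n] by (auto simp: rr'_def ss'_def stat_def mat_one_def)
    show "n \<le> m" if "0 < mat_pow (S n) (trans_mat S pu pd n) m (rr' n) (ss' n)"
      using that assms(13)[of n] by (cases "n = 0") (auto simp: rr'_def ss'_def)
    show "pd (Suc n) (rr' (Suc n)) (rr' n) = 1"
    proof (cases "n = 0")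
      \<comment> \<open>\<open>S 0\<close> is a singleton, so each row of \<open>pd 1\<close>
        consists of the single entry 1.\<close>
      case True
      then show ?thesis
        using stochastic_sum[OF assms(5)[of 1], of "rr 1"] assms(3,11) by (simp add: rr'_def)
    next
      case False
      then show ?thesis using assms(14)[of n] by (simp add: rr'_def)
    qed
  qed (fact chains.up_down_chains_axioms assms L_mono L_const)+
  show ?thesis
    unfolding sep_limit_def assms(25) using lim.separation by blast
qed

end
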